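(* Let $\chi_{1,p}$ denote the principal character modulo $p$. Then $$1+6\sum_{n\ge1}\frac{\chi_{1,5}(n)nq^n}{1-q^n}=\mathcal E_{1,5}^2+\mathcal E_{2,5}^2,\qquad 1+4\sum_{n\ge1}\frac{\chi_{1,7}(n)nq^n}{1-q^n}=\mathcal E_{1,7}^2+\mathcal E_{2,7}^2+\mathcal E_{3,7}^2,$$ $$1+2\sum_{n\ge1}\frac{\chi_{1,13}(n)nq^n}{1-q^n}=\mathcal E_{1,13}^2+\mathcal E_{2,13}^2+\mathcal E_{3,13}^2+\mathcal E_{4,13}^2+\mathcal E_{5,13}^2+\mathcal E_{7,13}^2.$$
   Context: $q=e^{2\pi i\tau}$. For a prime $p$ and an odd Dirichlet character $\chi$ mod $p$, $E_{1,\chi}(\tau)=1+\frac{2}{L(0,\chi)}\sum_{n\ge1}\chi(n)\frac{q^n}{1-q^n}$ ($L(0,\chi)$ the value at $0$ of the analytically continued $L$-function). For $a$ coprime to $p$, $\mathcal E_{a,p}=\frac{2}{p-1}\sum_{\chi\text{ odd}}\chi(a)E_{1,\chi}$ (equivalently $(\gamma_{21}\tau+\gamma_{22})^{-1}\mathcal E_{1,p}(\gamma\tau)$ for $\gamma\in SL(2,\mathbb Z)$, $\gamma_{21}\equiv0$, $\gamma_{22}\equiv a\pmod p$). *)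

theory Defs
  imports "HOL-Complex_Analysis.Complex_Analysis" "HOL-Computational_Algebra.Primes"
begin

text \<open>
  Characters are taken on the integers, so that oddness can be stated as
  \<open>\<psi> (-1) = -1\<close>. The equation \<open>\<psi> 1 = 1\<close> follows from
  multiplicativity together with \<open>\<psi> 1 \<noteq> 0\<close>.
\<close>

definition dirichlet_char :: "nat \<Rightarrow> (int \<Rightarrow> complex) \<Rightarrow> bool" where
  "dirichlet_char m \<psi> \<longleftrightarrow>
     (\<forall>a. \<psi> (a + int m) = \<psi> a) \<and>
     (\<forall>a b. \<psi> (a * b) = \<psi> a * \<psi> b) \<and>
     (\<forall>a. \<psi> a \<noteq> 0 \<longleftrightarrow> coprime a (int m))"

definition odd_chars :: "nat \<Rightarrow> (int \<Rightarrow> complex) set" where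
  "odd_chars m = {\<psi>. dirichlet_char m \<psi> \<and> \<psi> (-1) = -1}"

definition principal_char :: "nat \<Rightarrow> int \<Rightarrow> complex" where
  "principal_char m a = (if coprime a (int m) then 1 else 0)"

text \<open>
  The analytically continued L-function: the value at \<open>s\<close> of the holomorphic function
  on the complex plane without the point 1 that is given by the Dirichlet series
  for \<open>Re z > 1\<close>. That domain is connected, so there is at most one such function; the
  point 1 is excluded so that the definition also covers the principal characters, whose
  L-functions have a pole there.
\<close>

definition dirichlet_L :: "(int \<Rightarrow> complex) \<Rightarrow> complex \<Rightarrow> complex" where
  "dirichlet_L \<psi> s = (THE v. \<exists>f. f holomorphic_on (- {1}) \<and>
     (\<forall>z. Re z > 1 \<longrightarrow>
        (\<lambda>n. \<psi> (int (Suc n)) / of_nat (Suc n) powr z) sums f z) \<and> v = f s)"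

definition qpar :: "complex \<Rightarrow> complex" where
  "qpar \<tau> = exp (2 * of_real pi * \<i> * \<tau>)"

definition eis_char :: "(int \<Rightarrow> complex) \<Rightarrow> complex \<Rightarrow> complex" where
  "eis_char \<psi> \<tau> = 1 + 2 / dirichlet_L \<psi> 0 *
     (\<Sum>n. \<psi> (int (Suc n)) * (qpar \<tau> ^ Suc n / (1 - qpar \<tau> ^ Suc n)))"

definition eis :: "int \<Rightarrow> nat \<Rightarrow> complex \<Rightarrow> complex" where
  "eis a p \<tau> = 2 / (of_nat p - 1) * (\<Sum>\<psi>\<in>odd_chars p. \<psi> a * eis_char \<psi> \<tau>)"

definition lambert2 :: "nat \<Rightarrow> complex \<Rightarrow> complex" where
  "lambert2 p \<tau> = (\<Sum>n. principal_char p (int (Suc n)) * of_nat (Suc n) * qpar \<tau> ^ Suc n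
                         / (1 - qpar \<tau> ^ Suc n))"

end

theory Submission
  imports Defs "HOL-Number_Theory.Number_Theory"
begin

text \<open>
  With \<open>q = qpar \<tau>\<close>, \<open>F x = (\<Sum>m\<noteq>0. x^m / (1 - q^(p m)))\<close> and
  \<open>W a = 1/2 - a/p + F (q^a)\<close> for \<open>0 < a < p\<close>, extended to an odd \<open>p\<close>-periodic function,
  one has \<open>E_\<psi> = (\<Sum>a. \<psi> a * W a) / L(0,\<psi>)\<close> for odd \<open>\<psi>\<close>. Here \<open>L(0,\<psi>)\<close> is the same sum with
  \<open>W\<close> replaced by its limit \<open>1/2 - a/p\<close> at \<open>q = 0\<close>.

  Both functions satisfy \<open>(W a + W b - W (a + b))^2 = P a + P b + P (a + b)\<close>: this is the
  classical relation between the Weierstrass zeta and pe functions, and it follows from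
  \<open>1/(1-A) * 1/(1-B) = 1/(1-AB) * (1/(1-A) + 1/(1-B) - 1)\<close> by comparing Laurent coefficients.
  Summing it over \<open>(a, b) = (c, t c)\<close> gives linear relations between the autocorrelations
  \<open>R t = (\<Sum>a. W a * W (t a))\<close> and \<open>\<Sum>a. P a\<close>. For \<open>p = 5, 7, 13\<close> they determine every \<open>R t\<close> as a
  rational multiple of \<open>\<Sum>a. P a\<close>, depending on \<open>t\<close> only. Hence \<open>E_\<psi> * E_\<psi>'\<close>, where \<open>\<psi>'\<close> is the
  conjugate character, is the quotient of \<open>\<Sum>a. P a\<close> by its value at \<open>q = 0\<close>. This quotient is the
  left-hand side, and by orthogonality of characters the right-hand side is the mean of
  \<open>E_\<psi> * E_\<psi>'\<close> over the odd \<open>\<psi>\<close>.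
\<close>

subsection \<open>The value of L-functions at 0\<close>

text \<open>
  The Dirichlet series of a mean-zero periodic sequence is continued by repeated summation by
  parts: the mean-zero primitive is again periodic, and each step gains one power of \<open>n\<close>.
\<close>

definition mean_zero_primitive :: "nat \<Rightarrow> (nat \<Rightarrow> complex) \<Rightarrow> nat \<Rightarrow> complex" where
  "mean_zero_primitive p c n = (\<Sum>k=1..n. c k) - (\<Sum>j<p. \<Sum>k=1..j. c k) / of_nat p"

definition mean_zero_periodic :: "nat \<Rightarrow> (nat \<Rightarrow> complex) \<Rightarrow> bool" where
  "mean_zero_periodic p c \<longleftrightarrow> p > 0 \<and> (\<forall>n. c (n + p) = c n) \<and> (\<Sum>k<p. c k) = 0"

lemma mean_zero_primitive_Suc:
  "mean_zero_primitive p c (Suc n) - mean_zero_primitive p c n = c (Suc n)"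
  by (simp add: mean_zero_primitive_def)

lemma mean_zero_periodic_sum:
  assumes "mean_zero_periodic p c"
  shows "(\<Sum>k=n..<n+p. c k) = 0"
proof (induction n)
  case 0
  then show ?case using assms by (simp add: mean_zero_periodic_def atLeast0LessThan)
next
  case (Suc n)
  have "p > 0" "c (n + p) = c n" using assms by (auto simp: mean_zero_periodic_def)
  have "(\<Sum>k=n..<n+p. c k) + c (n + p) = (\<Sum>k=n..<Suc (n+p). c k)" by simp
  also have "\<dots> = c n + (\<Sum>k=Suc n..<Suc n+p. c k)"
    by (subst sum.atLeast_Suc_lessThan) auto
  finally show ?case using Suc \<open>c (n + p) = c n\<close> by simp
qed

lemma mean_zero_periodic_primitive:
  assumes "mean_zero_periodic p c"
  shows "mean_zero_periodic p (mean_zero_primitive p c)"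
proof -
  have "(\<Sum>k=1..n+p. c k) = (\<Sum>k=1..n. c k)" for n
  proof -
    have "(\<Sum>k=1..n+p. c k) = (\<Sum>k=1..n. c k) + (\<Sum>k=Suc n..n+p. c k)"
      by (induction p) auto
    also have "(\<Sum>k=Suc n..n+p. c k) = (\<Sum>k=Suc n..<Suc n+p. c k)"
      by (simp add: atLeastLessThanSuc_atLeastAtMost)
    finally show ?thesis using mean_zero_periodic_sum[OF assms, of "Suc n"] by simp
  qed
  moreover have "(\<Sum>k<p. mean_zero_primitive p c k) = 0" "p > 0"
    using assms by (auto simp: mean_zero_periodic_def mean_zero_primitive_def sum_subtractf)
  ultimately show ?thesis by (simp add: mean_zero_periodic_def mean_zero_primitive_def)
qed

lemma mean_zero_periodic_bounded:
  assumes "mean_zero_periodic p c"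
  obtains K where "K \<ge> 0" "\<And>n. norm (c n) \<le> K"
proof -
  have p: "p > 0" and per: "\<And>n. c (n + p) = c n" using assms by (auto simp: mean_zero_periodic_def)
  have *: "c (n + p * k) = c n" for n k
    by (induction k) (use per in \<open>auto simp: algebra_simps\<close>, metis add.assoc add.commute)
  have "c n = c (n mod p)" for n
    using *[of "n mod p" "n div p"] by simp
  then have "norm (c n) \<le> (\<Sum>k<p. norm (c k))" for n
    using p by (subst \<open>c n = c (n mod p)\<close>, intro member_le_sum[where f="\<lambda>k. norm (c k)"]) auto
  then show thesis using that[of "\<Sum>k<p. norm (c k)"] by (simp add: sum_nonneg)
qed

text \<open>Summation by parts. The boundary products \<open>?P n * g (Suc n)\<close> vanish in the
  limit because the primitive is bounded and \<open>g\<close> tends to 0, so only the term at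
  \<open>n = 0\<close> survives.\<close>

lemma abel_summation_sums:
  assumes c: "mean_zero_periodic p c" and g: "g \<longlonglongrightarrow> 0"
    and S: "(\<lambda>n. mean_zero_primitive p c (Suc n) * (g (Suc n) - g (Suc (Suc n)))) sums S"
  shows "(\<lambda>n. c (Suc n) * g (Suc n)) sums (S - mean_zero_primitive p c 0 * g 1)"
proof -
  let ?P = "mean_zero_primitive p c"
  obtain K where K: "\<And>n. norm (?P n) \<le> K"
    using mean_zero_periodic_bounded[OF mean_zero_periodic_primitive[OF c]] by metis
  have "(\<lambda>n. ?P n * g (Suc n)) \<longlonglongrightarrow> 0"
  proof (rule Lim_null_comparison)
    show "\<forall>\<^sub>F n in sequentially. norm (?P n * g (Suc n)) \<le> K * norm (g (Suc n))"
      unfolding norm_mult by (intro always_eventually allI mult_right_mono K) auto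
    show "(\<lambda>n. K * norm (g (Suc n))) \<longlonglongrightarrow> 0"
      by (intro tendsto_mult_right_zero tendsto_norm_zero g[THEN LIMSEQ_Suc])
  qed
  from telescope_sums[OF this]
  have "(\<lambda>n. ?P (Suc n) * g (Suc (Suc n)) - ?P n * g (Suc n)) sums (0 - ?P 0 * g 1)" by simp
  from sums_add[OF S this]
  have "(\<lambda>n. (?P (Suc n) - ?P n) * g (Suc n)) sums (S - ?P 0 * g 1)"
    by (simp add: algebra_simps)
  then show ?thesis by (simp only: mean_zero_primitive_Suc)
qed

section \<open>Iterated differences of complex powers\<close>

text \<open>This is \<open>(-1)^m\<close> times the \<open>m\<close>-th forward difference of
  \<open>z powr (-s)\<close>. With this sign it is the factor produced by \<open>m\<close>
  summations by parts.\<close>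

fun diff_powr :: "nat \<Rightarrow> complex \<Rightarrow> complex \<Rightarrow> complex" where
  "diff_powr 0 s z = z powr (-s)"
| "diff_powr (Suc m) s z = diff_powr m s z - diff_powr m s (z + 1)"

lemma has_field_derivative_diff_powr:
  assumes "Re z > 0"
  shows "(diff_powr m s has_field_derivative - s * diff_powr m (s + 1) z) (at z)"
  using assms
proof (induction m arbitrary: z)
  case 0
  have "z \<notin> \<real>\<^sub>\<le>\<^sub>0" using 0 by (auto simp: complex_nonpos_Reals_iff)
  then have "((\<lambda>z. z powr (-s)) has_field_derivative (-s) * z powr (-s - 1)) (at z)"
    by (rule has_field_derivative_powr)
  moreover have "diff_powr 0 s = (\<lambda>z. z powr (-s))" by (rule ext) simp
  moreover have "- s - 1 = - (s + 1)" by simp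
  ultimately show ?case by (metis diff_powr.simps(1))
next
  case (Suc m)
  have 1: "(diff_powr m s has_field_derivative - s * diff_powr m (s + 1) z) (at z)"
    using Suc by auto
  have 2: "((\<lambda>z. diff_powr m s (z + 1)) has_field_derivative - s * diff_powr m (s + 1) (z + 1)) (at z)"
    using Suc.IH[of "z + 1"] Suc.prems by (subst DERIV_shift[symmetric]) auto
  have "diff_powr (Suc m) s = (\<lambda>z. diff_powr m s z - diff_powr m s (z + 1))" by (rule ext) simp
  then show ?case using DERIV_diff[OF 1 2] by (simp add: algebra_simps)
qed

text \<open>A difference over a unit step is bounded by the supremum of the derivative on the
  segment, and that derivative is \<open>- s\<close> times a difference of one order less at
  \<open>s + 1\<close>. The quantity \<open>Re s + m\<close> is unchanged in passing from
  \<open>(s, Suc m)\<close> to \<open>(s + 1, m)\<close>; being nonnegative, it makes the bounding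
  power decreasing, so its supremum sits at the left end.\<close>

lemma norm_diff_powr_le:
  assumes "x > 0" "Re s + real m \<ge> 0"
  shows "norm (diff_powr m s (of_real x)) \<le> (\<Prod>j<m. norm (s + of_nat j)) * x powr (- Re s - real m)"
  using assms
proof (induction m arbitrary: s x)
  case 0
  then show ?case by (simp add: norm_powr_real_powr)
next
  case (Suc m)
  define C where "C = (\<Prod>j<m. norm (s + 1 + of_nat j))"
  have C: "C \<ge> 0" by (auto simp: C_def intro: prod_nonneg)
  have bound: "norm (- s * diff_powr m (s + 1) z) \<le> norm s * C * x powr (- Re s - real (Suc m))"
    if z: "z \<in> of_real ` {x..x+1}" for z
  proof -
    from z obtain y where y: "z = of_real y" "x \<le> y" by auto
    have "norm (diff_powr m (s + 1) z) \<le> C * y powr (- Re (s + 1) - real m)"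
      unfolding C_def y using Suc.IH[of y "s + 1"] y Suc.prems by auto
    also have "\<dots> \<le> C * x powr (- Re (s + 1) - real m)"
      using y Suc.prems C by (intro mult_left_mono powr_mono2') auto
    finally have "norm s * norm (diff_powr m (s + 1) z) \<le> norm s * (C * x powr (- Re (s + 1) - real m))"
      by (rule mult_left_mono) auto
    moreover have "- Re (s + 1) - real m = - Re s - real (Suc m)" by simp
    ultimately show ?thesis by (simp only: norm_mult norm_minus_cancel mult.assoc)
  qed
  have "norm (diff_powr m s (of_real x) - diff_powr m s (of_real (x + 1)))
        \<le> norm s * C * x powr (- Re s - real (Suc m)) * norm (of_real x - of_real (x + 1) :: complex)"
  proof (rule field_differentiable_bound[where S = "of_real ` {x..x+1}"])
    show "convex (complex_of_real ` {x..x+1})"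
      by (intro convex_linear_image bounded_linear.linear[OF bounded_linear_of_real]) auto
    show "of_real (x + 1) \<in> complex_of_real ` {x..x+1}" by (intro imageI) auto
    fix z assume z: "z \<in> complex_of_real ` {x..x+1}"
    then have "Re z > 0" using Suc.prems by auto
    then show "(diff_powr m s has_field_derivative - s * diff_powr m (s + 1) z)
        (at z within complex_of_real ` {x..x+1})"
      by (rule has_field_derivative_at_within[OF has_field_derivative_diff_powr])
  qed (use bound in auto)
  moreover have "norm s * C = (\<Prod>j<Suc m. norm (s + of_nat j))"
    by (simp only: C_def prod.lessThan_Suc_shift) (simp add: algebra_simps)
  ultimately show ?case by simp
qed

lemma holomorphic_diff_powr:
  assumes "x > 0"
  shows "(\<lambda>s. diff_powr m s (of_real x)) holomorphic_on A"
  using assms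
proof (induction m arbitrary: x)
  case 0
  then show ?case by (auto intro!: holomorphic_intros)
next
  case (Suc m)
  have "(\<lambda>s. diff_powr m s (of_real x) - diff_powr m s (of_real (x + 1))) holomorphic_on A"
    by (intro holomorphic_intros Suc.IH) (use Suc.prems in auto)
  then show ?case by simp
qed

lemma diff_powr_tendsto_0:
  assumes "Re s + real m > 0"
  shows "(\<lambda>n. diff_powr m s (of_nat n)) \<longlonglongrightarrow> 0"
proof (rule Lim_null_comparison)
  let ?C = "\<Prod>j<m. norm (s + of_nat j)"
  show "\<forall>\<^sub>F n in sequentially. norm (diff_powr m s (of_nat n)) \<le> ?C * real n powr (- Re s - real m)"
  proof (rule eventually_sequentiallyI[of 1])
    fix n :: nat assume "n \<ge> 1"
    then show "norm (diff_powr m s (of_nat n)) \<le> ?C * real n powr (- Re s - real m)"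
      using norm_diff_powr_le[of "real n" s m] assms by simp
  qed
  have "(\<lambda>n. real n powr (- Re s - real m)) \<longlonglongrightarrow> 0"
    by (rule tendsto_neg_powr[OF _ filterlim_real_sequentially]) (use assms in auto)
  then show "(\<lambda>n. ?C * real n powr (- Re s - real m)) \<longlonglongrightarrow> 0"
    by (rule tendsto_mult_right_zero)
qed

section \<open>Analytic continuation of periodic Dirichlet series\<close>

definition iter_primitive :: "nat \<Rightarrow> (nat \<Rightarrow> complex) \<Rightarrow> nat \<Rightarrow> nat \<Rightarrow> complex" where
  "iter_primitive p c m = (mean_zero_primitive p ^^ m) c"

text \<open>The Dirichlet series after \<open>m\<close> summations by parts: the infinite sum
  converges for \<open>Re s > 1 - m\<close>, and the finite sum collects the boundary terms at
  \<open>n = 0\<close>.\<close>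

definition abel_L :: "nat \<Rightarrow> (nat \<Rightarrow> complex) \<Rightarrow> nat \<Rightarrow> complex \<Rightarrow> complex" where
  "abel_L p c m s = (\<Sum>n. iter_primitive p c m (Suc n) * diff_powr m s (of_nat (Suc n)))
     - (\<Sum>j<m. iter_primitive p c (Suc j) 0 * diff_powr j s 1)"

lemma mean_zero_periodic_iter:
  "mean_zero_periodic p c \<Longrightarrow> mean_zero_periodic p (iter_primitive p c m)"
  by (induction m) (auto simp: iter_primitive_def mean_zero_periodic_primitive)

text \<open>The right-hand side no longer involves \<open>s\<close>, as the Weierstrass M-test on
  discs requires.\<close>

lemma norm_diff_powr_le_uniform:
  assumes "d > 0" "Re s + real m \<ge> 1 + d" "norm s \<le> R"
  shows "norm (diff_powr m s (of_nat (Suc n))) \<le> (R + real m) ^ m * real (Suc n) powr (-1 - d)"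
proof -
  have "norm (diff_powr m s (of_real (real (Suc n))))
        \<le> (\<Prod>j<m. norm (s + of_nat j)) * real (Suc n) powr (- Re s - real m)"
    by (rule norm_diff_powr_le) (use assms in auto)
  also have "\<dots> \<le> (\<Prod>j<m. R + real m) * real (Suc n) powr (-1 - d)"
  proof (rule mult_mono)
    have "norm (s + of_nat j) \<le> R + real m" if "j < m" for j
      using norm_triangle_ineq[of s "of_nat j"] assms that by simp
    then show "(\<Prod>j<m. norm (s + of_nat j)) \<le> (\<Prod>j<m. R + real m)"
      by (intro prod_mono) auto
    show "real (Suc n) powr (- Re s - real m) \<le> real (Suc n) powr (-1 - d)"
      using assms by (intro powr_mono) auto
    have "R \<ge> 0" using assms norm_ge_zero[of s] by linarith
    then show "0 \<le> (\<Prod>j<m. R + real m)" by simp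
  qed auto
  finally show ?thesis by simp
qed

lemma summable_Suc_powr:
  assumes "d > 0"
  shows "summable (\<lambda>n. real (Suc n) powr (-1 - d))"
  by (subst summable_Suc_iff, subst summable_real_powr_iff) (use assms in auto)

lemma summable_abel_L:
  assumes c: "mean_zero_periodic p c" and s: "Re s + real m > 1"
  shows "summable (\<lambda>n. iter_primitive p c m (Suc n) * diff_powr m s (of_nat (Suc n)))"
proof -
  obtain K where K: "K \<ge> 0" "\<And>n. norm (iter_primitive p c m n) \<le> K"
    using mean_zero_periodic_bounded[OF mean_zero_periodic_iter[OF c]] by metis
  define d where "d = Re s + real m - 1"
  show ?thesis
  proof (rule summable_comparison_test)
    show "\<exists>N. \<forall>n\<ge>N. norm (iter_primitive p c m (Suc n) * diff_powr m s (of_nat (Suc n)))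
             \<le> K * ((norm s + real m) ^ m * real (Suc n) powr (-1 - d))"
      unfolding norm_mult using s
      by (intro exI[of _ 0] allI impI mult_mono K norm_diff_powr_le_uniform) (auto simp: d_def)
    show "summable (\<lambda>n. K * ((norm s + real m) ^ m * real (Suc n) powr (-1 - d)))"
      by (intro summable_mult summable_Suc_powr) (use s in \<open>auto simp: d_def\<close>)
  qed
qed

lemma abel_L_0_sums:
  assumes c: "mean_zero_periodic p c" and s: "Re s > 1"
  shows "(\<lambda>n. c (Suc n) / of_nat (Suc n) powr s) sums abel_L p c 0 s"
  using summable_sums[OF summable_abel_L[OF c, of s 0]] s
  by (simp add: abel_L_def iter_primitive_def powr_minus divide_inverse del: of_nat_Suc)

text \<open>One summation by parts with \<open>g n = diff_powr m s n\<close>, whose consecutive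
  differences are \<open>diff_powr (Suc m) s n\<close>. The new boundary term is the summand
  \<open>j = m\<close> of the finite sum.\<close>

lemma abel_L_Suc:
  assumes c: "mean_zero_periodic p c" and s: "Re s + real m > 1"
  shows "abel_L p c (Suc m) s = abel_L p c m s"
proof -
  have eq: "iter_primitive p c (Suc m) = mean_zero_primitive p (iter_primitive p c m)"
    by (simp add: iter_primitive_def)
  have "(\<lambda>n. iter_primitive p c (Suc m) (Suc n) * diff_powr (Suc m) s (of_nat (Suc n)))
          sums (\<Sum>n. iter_primitive p c (Suc m) (Suc n) * diff_powr (Suc m) s (of_nat (Suc n)))"
    by (rule summable_sums[OF summable_abel_L[OF c]]) (use s in auto)
  then have "(\<lambda>n. iter_primitive p c (Suc m) (Suc n) * (diff_powr m s (of_nat (Suc n)) - diff_powr m s (of_nat (Suc (Suc n)))))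
      sums (\<Sum>n. iter_primitive p c (Suc m) (Suc n) * diff_powr (Suc m) s (of_nat (Suc n)))"
    by (simp add: add_ac)
  from abel_summation_sums[OF mean_zero_periodic_iter[OF c] diff_powr_tendsto_0 this[unfolded eq]] s
  have "(\<Sum>n. iter_primitive p c m (Suc n) * diff_powr m s (of_nat (Suc n))) =
     (\<Sum>n. iter_primitive p c (Suc m) (Suc n) * diff_powr (Suc m) s (of_nat (Suc n)))
      - iter_primitive p c (Suc m) 0 * diff_powr m s 1"
    by (auto dest: sums_unique simp: eq)
  then show ?thesis by (simp add: abel_L_def)
qed

lemma abel_L_mono:
  assumes c: "mean_zero_periodic p c" and s: "Re s + real m > 1" and "m \<le> n"
  shows "abel_L p c n s = abel_L p c m s"
  using \<open>m \<le> n\<close>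
proof (induction n rule: dec_induct)
  case (step k)
  then show ?case using abel_L_Suc[OF c, of s k] s by simp
qed simp

lemma holomorphic_abel_L:
  assumes c: "mean_zero_periodic p c"
  shows "abel_L p c m holomorphic_on {s. Re s + real m > 1}"
proof -
  let ?S = "{s. Re s + real m > 1}"
  let ?f = "\<lambda>n s. iter_primitive p c m (Suc n) * diff_powr m s (of_nat (Suc n))"
  obtain K where K: "K \<ge> 0" "\<And>n. norm (iter_primitive p c m n) \<le> K"
    using mean_zero_periodic_bounded[OF mean_zero_periodic_iter[OF c]] by metis
  have "?S = {s. Re s > 1 - real m}" by auto
  then have op: "open ?S" by (simp add: open_halfspace_Re_gt)
  have hol: "?f n holomorphic_on A" for n A
    using holomorphic_diff_powr[of "real (Suc n)" m A] by (auto intro!: holomorphic_intros)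
  have "(\<lambda>s. \<Sum>n. ?f n s) holomorphic_on ?S"
  proof (rule holomorphic_uniform_sequence[OF op])
    show "(\<lambda>s. \<Sum>i<n. ?f i s) holomorphic_on ?S" for n
      by (intro holomorphic_intros hol)
    fix z assume z: "z \<in> ?S"
    \<comment> \<open>Half the distance from \<open>z\<close> to the boundary line, so the closed
      disc of this radius keeps distance \<open>d\<close> from it.\<close>
    define d where "d = (Re z + real m - 1) / 2"
    have d: "d > 0" using z by (simp add: d_def)
    have cb: "Re s + real m \<ge> 1 + d" "norm s \<le> norm z + d" if "s \<in> cball z d" for s
    proof -
      have "norm (z - s) \<le> d" using that by (simp add: dist_norm)
      then have "Re z - Re s \<le> d" using complex_Re_le_cmod[of "z - s"] by simp
      then show "Re s + real m \<ge> 1 + d" by (simp add: d_def field_simps)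
      show "norm s \<le> norm z + d" using \<open>norm (z - s) \<le> d\<close>
        by (metis add_left_mono norm_minus_commute norm_triangle_sub order_trans)
    qed
    have "uniform_limit (cball z d) (\<lambda>n s. \<Sum>i<n. ?f i s) (\<lambda>s. \<Sum>n. ?f n s) sequentially"
    proof (rule Weierstrass_m_test)
      show "norm (?f n s) \<le> K * ((norm z + d + real m) ^ m * real (Suc n) powr (-1 - d))"
        if "s \<in> cball z d" for n s
        unfolding norm_mult using d cb[OF that]
        by (intro mult_mono K norm_diff_powr_le_uniform) auto
      show "summable (\<lambda>n. K * ((norm z + d + real m) ^ m * real (Suc n) powr (-1 - d)))"
        by (intro summable_mult summable_Suc_powr d)
    qed
    moreover have "cball z d \<subseteq> ?S" using cb d by force
    ultimately show "\<exists>d>0. cball z d \<subseteq> ?S \<and>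
        uniform_limit (cball z d) (\<lambda>n s. \<Sum>i<n. ?f i s) (\<lambda>s. \<Sum>n. ?f n s) sequentially"
      using d by blast
  qed
  moreover have "(\<lambda>s. \<Sum>j<m. iter_primitive p c (Suc j) 0 * diff_powr j s 1) holomorphic_on ?S"
    using holomorphic_diff_powr[of 1] by (auto intro!: holomorphic_intros)
  ultimately show ?thesis unfolding abel_L_def[abs_def] by (intro holomorphic_on_diff)
qed

text \<open>The functions \<open>abel_L p c m\<close> agree wherever the smaller order converges, so
  they glue to an entire function. Its value at 0 is the mean of the partial sums over one
  period.\<close>

lemma dirichlet_series_continuation:
  assumes c: "mean_zero_periodic p c"
  obtains f where "f holomorphic_on UNIV"
    "\<And>s. Re s > 1 \<Longrightarrow> (\<lambda>n. c (Suc n) / of_nat (Suc n) powr s) sums f s"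
    "f 0 = (\<Sum>j<p. \<Sum>k=1..j. c k) / of_nat p"
proof
  define M where "M s = nat \<lceil>2 - Re s\<rceil>" for s
  define f where "f s = abel_L p c (M s) s" for s
  have M: "Re s + real (M s) > 1" for s
    unfolding M_def by linarith
  have f_eq: "f s = abel_L p c m s" if "Re s + real m > 1" for s m
    using abel_L_mono[OF c M, of s m] abel_L_mono[OF c that, of "M s"] unfolding f_def
    by (cases "m \<le> M s") auto
  show "f holomorphic_on UNIV"
  proof (rule holomorphic_onI)
    fix s :: complex
    let ?S = "{z. Re z + real (M s) > 1}"
    have "?S = {z. Re z > 1 - real (M s)}" by auto
    then have op: "open ?S" by (simp add: open_halfspace_Re_gt)
    have "f holomorphic_on ?S"
      using holomorphic_abel_L[OF c, of "M s"] by (rule holomorphic_transform) (simp add: f_eq)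
    then show "f field_differentiable at s within UNIV"
      using op M[of s] by (auto dest: holomorphic_on_imp_differentiable_at)
  qed
  show "(\<lambda>n. c (Suc n) / of_nat (Suc n) powr s) sums f s" if "Re s > 1" for s
    using abel_L_0_sums[OF c that] f_eq[of s 0] that by simp
  \<comment> \<open>At \<open>s = 0\<close> the order 2 suffices. There \<open>z powr 0 = 1\<close>,
    so all differences of positive order vanish and only the boundary term \<open>j = 0\<close>
    remains. Nonzero bases matter since \<open>0 powr 0 = 0\<close>.\<close>
  have "diff_powr (Suc (Suc 0)) 0 (of_nat (Suc n)) = 0" for n
  proof -
    have "of_nat (Suc n) \<noteq> (0 :: complex)" "of_nat (Suc n) + 1 \<noteq> (0 :: complex)"
      "of_nat (Suc n) + 1 + 1 \<noteq> (0 :: complex)"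
      using of_nat_neq_0[where 'a = complex, of n] of_nat_neq_0[where 'a = complex, of "Suc n"]
        of_nat_neq_0[where 'a = complex, of "Suc (Suc n)"] by (simp_all add: add_ac)
    then show ?thesis by (simp del: of_nat_Suc)
  qed
  moreover have "f 0 = abel_L p c (Suc (Suc 0)) 0" by (rule f_eq) simp
  ultimately have "f 0 = - mean_zero_primitive p c 0"
    by (simp add: abel_L_def iter_primitive_def del: of_nat_Suc diff_powr.simps(2)) simp
  then show "f 0 = (\<Sum>j<p. \<Sum>k=1..j. c k) / of_nat p"
    by (simp add: mean_zero_primitive_def)
qed

section \<open>Uniqueness of the continuation and its value at 0\<close>

text \<open>The identity theorem on the connected punctured plane: any two candidates agree on the
  half-plane \<open>Re z > 1\<close>, hence at every \<open>s\<close> other than 1, and the definite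
  description is met by \<open>f s\<close>.\<close>

lemma dirichlet_L_eqI:
  assumes f: "f holomorphic_on UNIV"
    and sums: "\<And>z. Re z > 1 \<Longrightarrow> (\<lambda>n. \<psi> (int (Suc n)) / of_nat (Suc n) powr z) sums f z"
    and s: "s \<noteq> 1"
  shows "dirichlet_L \<psi> s = f s"
  unfolding dirichlet_L_def
proof (rule the_equality)
  show "\<exists>g. g holomorphic_on (- {1}) \<and>
     (\<forall>z. Re z > 1 \<longrightarrow> (\<lambda>n. \<psi> (int (Suc n)) / of_nat (Suc n) powr z) sums g z) \<and> f s = g s"
    using f sums holomorphic_on_subset by blast
  fix v assume "\<exists>g. g holomorphic_on (- {1}) \<and>
     (\<forall>z. Re z > 1 \<longrightarrow> (\<lambda>n. \<psi> (int (Suc n)) / of_nat (Suc n) powr z) sums g z) \<and> v = g s"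
  then obtain g where g: "g holomorphic_on (- {1})" "v = g s"
    "\<And>z. Re z > 1 \<Longrightarrow> (\<lambda>n. \<psi> (int (Suc n)) / of_nat (Suc n) powr z) sums g z" by auto
  have "g s = f s"
  proof (rule analytic_continuation_open[where s = "{z. Re z > 1}" and s' = "- {1}" and f = g and g = f])
    show "open {z. Re z > 1}" by (rule open_halfspace_Re_gt)
    have "2 \<in> {z. Re z > 1}" by simp
    then show "{z. Re z > 1} \<noteq> {}" by blast
    show "connected (- {1 :: complex})" by (rule connected_punctured_universe) simp
    show "f holomorphic_on - {1}" using f holomorphic_on_subset by blast
    show "g z = f z" if "z \<in> {z. Re z > 1}" for z
      using sums_unique2[OF g(3) sums, of z] that by simp
  qed (use g s in auto)
  then show "v = f s" using g by simp
qed

lemma dirichlet_L_0: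
  assumes p: "p > 0" and per: "\<And>a. \<psi> (a + int p) = \<psi> a" and \<psi>0: "\<psi> 0 = 0"
    and zero: "(\<Sum>k<p. \<psi> (int k)) = 0"
  shows "dirichlet_L \<psi> 0 = - (\<Sum>k<p. of_nat k * \<psi> (int k)) / of_nat p"
proof -
  have c: "mean_zero_periodic p (\<lambda>n. \<psi> (int n))"
    using assms by (simp add: mean_zero_periodic_def)
  obtain f where f: "f holomorphic_on UNIV"
    "\<And>s. Re s > 1 \<Longrightarrow> (\<lambda>n. \<psi> (int (Suc n)) / of_nat (Suc n) powr s) sums f s"
    "f 0 = (\<Sum>j<p. \<Sum>k=1..j. \<psi> (int k)) / of_nat p"
    by (rule dirichlet_series_continuation[OF c]) blast
  \<comment> \<open>The value \<open>\<psi> k\<close> occurs in the partial sums with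
    \<open>j = k, ..., n - 1\<close>, that is \<open>n - k\<close> times. For \<open>n = p\<close>
    the multiple of \<open>p\<close> drops out by mean zero, which leaves minus the generalized
    Bernoulli number.\<close>
  have *: "(\<Sum>j<n. \<Sum>k=1..j. \<psi> (int k)) = of_nat n * (\<Sum>k=1..<n. \<psi> (int k)) - (\<Sum>k=1..<n. of_nat k * \<psi> (int k))"
    if "n > 0" for n
    using that
  proof (induction n rule: nat_induct_non_zero)
    case (Suc n)
    have "{1..n} = insert n {1..<n}" using Suc by auto
    then show ?case using Suc by (simp add: atLeastLessThanSuc algebra_simps)
  qed simp
  have split: "{..<p} = insert 0 {1..<p}" using p by auto
  have "(\<Sum>k=1..<p. \<psi> (int k)) = 0" using zero \<psi>0 by (subst (asm) split) simp
  moreover have "(\<Sum>k<p. of_nat k * \<psi> (int k)) = (\<Sum>k=1..<p. of_nat k * \<psi> (int k))"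
    by (subst split) simp
  ultimately have "f 0 = - (\<Sum>k<p. of_nat k * \<psi> (int k)) / of_nat p"
    using f(3) *[OF p] by simp
  then show ?thesis using dirichlet_L_eqI[where s = 0, OF f(1)] f(2) by simp
qed

subsection \<open>Odd characters modulo a prime\<close>

locale odd_prime =
  fixes p :: nat
  assumes prime_p: "prime p" and odd_p: "odd p"
begin

section \<open>Residues modulo p and sums over units\<close>

abbreviation units :: "int set" where "units \<equiv> {1..<int p}"

lemma p_gt_2: "p > 2"
  using prime_p odd_p prime_ge_2_nat[of p] by (cases "p = 2") auto

lemma coprime_iff: "coprime a (int p) \<longleftrightarrow> \<not> int p dvd a"
  using prime_p
  by (metis coprime_commute not_coprimeE coprime_absorb_left prime_imp_coprime prime_nat_int_transfer not_prime_unit)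

lemma unitsD: "a \<in> units \<Longrightarrow> \<not> int p dvd a"
  using zdvd_imp_le by fastforce

lemma mod_in_units: "\<not> int p dvd a \<Longrightarrow> a mod int p \<in> units"
  using p_gt_2 by (simp add: dvd_eq_mod_eq_0) (metis pos_mod_sign not_less_iff_gr_or_eq of_nat_0_less_iff order.strict_trans pos_mod_bound zero_less_numeral zless_add1_eq linorder_not_less add.left_neutral int_one_le_iff_zero_less)

lemma dvd_mult_iff: "int p dvd a * b \<longleftrightarrow> int p dvd a \<or> int p dvd b"
  using prime_p by (simp add: prime_dvd_mult_iff)

lemma periodic_mod:
  assumes "\<And>a. f (a + int p) = f a"
  shows "f (a mod int p) = f a"
proof -
  have nat: "f (x + int p * int k) = f x" for x k
  proof (induction k)
    case (Suc k)
    then show ?case using assms[of "x + int p * int k"] by (simp add: algebra_simps)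
  qed simp
  have "f (x + int p * k) = f x" for x k
  proof (cases "k \<ge> 0")
    case True
    then show ?thesis using nat[of x "nat k"] by simp
  next
    case False
    then show ?thesis using nat[of "x + int p * k" "nat (-k)"] by simp
  qed
  from this[of "a mod int p" "a div int p"] show ?thesis by simp
qed

text \<open>Multiplication by a unit is an injective map of the finite set of units into itself,
  hence a permutation.\<close>

lemma sum_units_mult:
  fixes f :: "int \<Rightarrow> 'b :: comm_monoid_add"
  assumes f: "\<And>a. f (a + int p) = f a" and t: "\<not> int p dvd t"
  shows "(\<Sum>a\<in>units. f (t * a)) = (\<Sum>a\<in>units. f a)"
proof -
  have inj: "inj_on (\<lambda>a. (t * a) mod int p) units"
  proof (rule inj_onI)
    fix a b assume ab: "a \<in> units" "b \<in> units" "(t * a) mod int p = (t * b) mod int p"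
    then have "int p dvd t * (a - b)"
      by (simp add: mod_eq_dvd_iff right_diff_distrib)
    then have "int p dvd a - b" using t by (simp add: dvd_mult_iff)
    then have "a mod int p = b mod int p" by (simp add: mod_eq_dvd_iff)
    then show "a = b" using ab by simp
  qed
  moreover have "(\<lambda>a. (t * a) mod int p) ` units \<subseteq> units"
    using t unitsD by (auto intro!: mod_in_units simp del: atLeastLessThan_iff simp: dvd_mult_iff)
  ultimately have "bij_betw (\<lambda>a. (t * a) mod int p) units units"
    by (simp add: bij_betw_def endo_inj_surj)
  then have "(\<Sum>a\<in>units. f ((t * a) mod int p)) = (\<Sum>a\<in>units. f a)"
    by (rule sum.reindex_bij_betw)
  then show ?thesis by (simp only: periodic_mod[of f, OF f])
qed

lemma sum_units_neg:
  fixes f :: "int \<Rightarrow> 'b :: comm_monoid_add"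
  assumes f: "\<And>a. f (a + int p) = f a"
  shows "(\<Sum>a\<in>units. f (- a)) = (\<Sum>a\<in>units. f a)"
  using sum_units_mult[of f "-1"] f p_gt_2 by simp

section \<open>Values and orthogonality of characters\<close>

context
  fixes \<psi> assumes \<psi>: "dirichlet_char p \<psi>"
begin

lemma char_periodic: "\<psi> (a + int p) = \<psi> a"
  and char_mult: "\<psi> (a * b) = \<psi> a * \<psi> b"
  and char_eq_0_iff: "\<psi> a = 0 \<longleftrightarrow> int p dvd a"
  using \<psi> coprime_iff by (auto simp: dirichlet_char_def)

lemma char_1: "\<psi> 1 = 1"
  using char_mult[of 1 1] char_eq_0_iff[of 1] p_gt_2 by simp

lemma char_power: "\<psi> (a ^ n) = \<psi> a ^ n"
  by (induction n) (auto simp: char_1 char_mult)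

lemma char_mod: "\<psi> (a mod int p) = \<psi> a"
  by (rule periodic_mod) (rule char_periodic)

lemma char_cong: "[a = b] (mod int p) \<Longrightarrow> \<psi> a = \<psi> b"
  by (metis char_mod cong_def)

lemma char_power_eq_1:
  assumes "\<not> int p dvd a"
  shows "\<psi> a ^ (p - 1) = 1"
proof -
  have "[a ^ (p - 1) = 1] (mod int p)"
  proof -
    have a: "a mod int p \<in> units" using assms by (rule mod_in_units)
    then have "\<not> p dvd nat (a mod int p)" using unitsD[OF a] by (simp flip: int_dvd_int_iff)
    with prime_p have "[nat (a mod int p) ^ (p - 1) = 1] (mod p)" by (rule fermat_theorem)
    then have "[int (nat (a mod int p)) ^ (p - 1) = 1] (mod int p)"
      by (metis cong_int_iff of_nat_1 of_nat_power)
    then show ?thesis using a by (simp add: cong_def power_mod)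
  qed
  from char_cong[OF this] show ?thesis by (simp add: char_power char_1)
qed

lemma norm_char:
  assumes "\<not> int p dvd a"
  shows "norm (\<psi> a) = 1"
  using power_eq_1_iff[OF char_power_eq_1[OF assms]] p_gt_2 by simp

lemma char_mult_cnj:
  assumes "\<not> int p dvd a"
  shows "\<psi> a * cnj (\<psi> a) = 1"
  using norm_char[OF assms] by (simp add: complex_norm_square[symmetric])

end

lemma odd_charsD:
  assumes "\<psi> \<in> odd_chars p"
  shows "dirichlet_char p \<psi>" "\<psi> (- a) = - \<psi> a"
proof -
  show \<psi>: "dirichlet_char p \<psi>" using assms by (simp add: odd_chars_def)
  show "\<psi> (- a) = - \<psi> a"
    using char_mult[OF \<psi>, of "-1" a] assms by (simp add: odd_chars_def)
qed

lemma cnj_odd_char: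
  assumes "\<psi> \<in> odd_chars p"
  shows "(\<lambda>a. cnj (\<psi> a)) \<in> odd_chars p"
  using assms by (auto simp: odd_chars_def dirichlet_char_def)

text \<open>Orthogonality with the conjugate moved to the other side, the form in which squares of
  character sums need it. If \<open>\<phi>\<close> differs from the conjugate of
  \<open>\<psi>\<close> at \<open>c\<close>, replacing \<open>a\<close> by \<open>c * a\<close>
  multiplies the sum by \<open>\<psi> c * \<phi> c\<close>, which is not 1, so the sum is 0.\<close>

lemma sum_char_mult_char:
  assumes \<psi>: "dirichlet_char p \<psi>" and \<phi>: "dirichlet_char p \<phi>"
  shows "(\<Sum>a\<in>units. \<psi> a * \<phi> a) = (if \<phi> = (\<lambda>a. cnj (\<psi> a)) then of_nat p - 1 else 0)"
proof (cases "\<phi> = (\<lambda>a. cnj (\<psi> a))")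
  case True
  have "(\<Sum>a\<in>units. \<psi> a * \<phi> a) = (\<Sum>a\<in>units. 1)"
    using True char_mult_cnj[OF \<psi> unitsD] by (intro sum.cong) auto
  also have "\<dots> = of_nat p - 1" using p_gt_2 by (simp add: of_nat_diff)
  finally show ?thesis using True by simp
next
  case False
  then obtain c where c: "\<phi> c \<noteq> cnj (\<psi> c)" by auto
  have cu: "\<not> int p dvd c"
    using c char_eq_0_iff[OF \<psi>, of c] char_eq_0_iff[OF \<phi>, of c] by auto
  have "\<psi> c * \<phi> c \<noteq> 1"
    using c char_mult_cnj[OF \<psi> cu] by (metis mult_cancel_left mult_zero_left zero_neq_one)
  moreover have "(\<Sum>a\<in>units. \<psi> a * \<phi> a) = (\<Sum>a\<in>units. \<psi> (c * a) * \<phi> (c * a))"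
    using cu by (intro sum_units_mult[symmetric]) (auto simp: char_periodic[OF \<psi>] char_periodic[OF \<phi>])
  moreover have "(\<Sum>a\<in>units. \<psi> (c * a) * \<phi> (c * a)) = (\<psi> c * \<phi> c) * (\<Sum>a\<in>units. \<psi> a * \<phi> a)"
    by (simp add: char_mult[OF \<psi>] char_mult[OF \<phi>] sum_distrib_left mult_ac)
  ultimately show ?thesis using False by (metis mult_cancel_right1)
qed

lemma sum_char:
  assumes \<psi>: "\<psi> \<in> odd_chars p"
  shows "(\<Sum>a\<in>units. \<psi> a) = 0"
proof -
  have "(\<Sum>a\<in>units. \<psi> a) = - (\<Sum>a\<in>units. \<psi> a)"
    using sum_units_neg[of \<psi>] char_periodic[OF odd_charsD(1)[OF \<psi>]] odd_charsD(2)[OF \<psi>]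
    by (simp add: sum_negf)
  then show ?thesis by simp
qed

section \<open>Counting odd characters by means of a primitive root\<close>

text \<open>The half power of a generator squares to 1 but is not 1, since the order is
  \<open>p - 1\<close>; as \<open>p\<close> is prime, it is -1.\<close>

lemma primitive_root:
  obtains g :: int where "\<not> int p dvd g" "[g ^ ((p - 1) div 2) = -1] (mod int p)"
    "\<And>a. \<not> int p dvd a \<Longrightarrow> \<exists>k. [a = g ^ k] (mod int p)"
    "\<And>i j. [g ^ i = g ^ j] (mod int p) \<longleftrightarrow> [i = j] (mod (p - 1))"
proof -
  obtain g where g: "residue_primroot p g"
    using prime_primitive_root_exists[of p] prime_p p_gt_2 by auto
  have ord: "ord p g = p - 1" and cop: "coprime p g"
    using g prime_p by (auto simp: residue_primroot_def totient_prime)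
  have inj: "[int g ^ i = int g ^ j] (mod int p) \<longleftrightarrow> [i = j] (mod (p - 1))" for i j
    using order_divides_expdiff[OF cop, of i j] ord by (simp add: cong_int_iff flip: of_nat_power)
  have unit: "\<not> int p dvd int g"
    using cop prime_p by (metis coprime_absorb_left int_dvd_int_iff not_prime_unit)
  let ?h = "(p - 1) div 2"
  have h: "p - 1 = 2 * ?h" "?h > 0" using odd_p p_gt_2 by (auto elim: oddE)
  have "[int g ^ (2 * ?h) = int g ^ 0] (mod int p)"
    unfolding inj using h by (simp add: cong_def)
  then have "int p dvd (int g ^ ?h) ^ 2 - 1"
    by (simp add: cong_iff_dvd_diff flip: power_mult) (simp add: mult.commute)
  moreover have "(int g ^ ?h) ^ 2 - 1 = (int g ^ ?h - 1) * (int g ^ ?h + 1)"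
    by (simp add: power2_eq_square algebra_simps)
  moreover have "\<not> int p dvd int g ^ ?h - 1"
  proof
    assume "int p dvd int g ^ ?h - 1"
    then have "[int g ^ ?h = int g ^ 0] (mod int p)" by (simp add: cong_iff_dvd_diff)
    then have "(p - 1) dvd ?h" unfolding inj by (simp add: cong_0_iff)
    then show False using h by (metis dvd_imp_le less_add_same_cancel1 linorder_not_less mult_2)
  qed
  ultimately have "int p dvd int g ^ ?h + 1" by (simp add: dvd_mult_iff)
  then have minus: "[int g ^ ?h = -1] (mod int p)" by (simp add: cong_iff_dvd_diff)
  have "\<exists>k. [a = int g ^ k] (mod int p)" if "\<not> int p dvd a" for a
  proof -
    have a: "a mod int p \<in> units" using that by (rule mod_in_units)
    then have "nat (a mod int p) \<in> totatives p"
      using prime_p by (auto simp: totatives_prime)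
    then obtain k where k: "nat (a mod int p) = g ^ k mod p"
      using residue_primroot_is_generator[OF _ g] p_gt_2 by (auto simp: bij_betw_def)
    have "a mod int p = int (nat (a mod int p))" using a by simp
    also have "\<dots> = int g ^ k mod int p" by (simp only: k zmod_int of_nat_power)
    finally show ?thesis by (auto simp: cong_def)
  qed
  then show thesis using that[OF unit minus _ inj] by blast
qed

text \<open>A character is determined by its value \<open>z\<close> at a generator \<open>g\<close>,
  and because \<open>g ^ ((p - 1) div 2)\<close> is -1, oddness says exactly that the same power of
  \<open>z\<close> is -1. Conversely such a \<open>z\<close> defines a character through discrete
  logarithms.\<close>

lemma odd_chars_bij:
  obtains g where "bij_betw (\<lambda>\<psi>. \<psi> g) (odd_chars p) {z. z ^ ((p - 1) div 2) = -1}"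
proof -
  let ?h = "(p - 1) div 2"
  have h: "p - 1 = 2 * ?h" using odd_p by (metis even_Suc even_two_times_div_two odd_pos Suc_pred' )
  obtain g :: int where g: "\<not> int p dvd g" "[g ^ ?h = -1] (mod int p)"
    "\<And>a. \<not> int p dvd a \<Longrightarrow> \<exists>k. [a = g ^ k] (mod int p)"
    "\<And>i j. [g ^ i = g ^ j] (mod int p) \<longleftrightarrow> [i = j] (mod (p - 1))"
    by (rule primitive_root) blast
  have "bij_betw (\<lambda>\<psi>. \<psi> g) (odd_chars p) {z. z ^ ?h = -1}"
  proof (rule bij_betwI')
    fix \<psi> \<phi> assume odd: "\<psi> \<in> odd_chars p" "\<phi> \<in> odd_chars p"
    note chars = odd[THEN odd_charsD(1)]
    show "\<psi> g = \<phi> g \<longleftrightarrow> \<psi> = \<phi>"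
    proof
      assume eq: "\<psi> g = \<phi> g"
      show "\<psi> = \<phi>"
      proof
        fix a
        show "\<psi> a = \<phi> a"
        proof (cases "int p dvd a")
          case True
          then show ?thesis using char_eq_0_iff[OF chars(1), of a] char_eq_0_iff[OF chars(2), of a] by simp
        next
          case False
          then obtain k where k: "[a = g ^ k] (mod int p)" using g(3) by blast
          then show ?thesis 
            using eq char_cong[OF chars(1) k] char_cong[OF chars(2) k]
              char_power[OF chars(1)] char_power[OF chars(2)] by simp
        qed
      qed
    qed simp
  next
    fix \<psi> assume odd: "\<psi> \<in> odd_chars p"
    have "\<psi> (g ^ ?h) = \<psi> (-1)" by (rule char_cong[OF odd_charsD(1)[OF odd] g(2)])
    then show "\<psi> g \<in> {z. z ^ ?h = -1}"
      using odd char_power[OF odd_charsD(1)[OF odd]] by (simp add: odd_chars_def)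
  next
    fix z :: complex assume z: "z \<in> {z. z ^ ?h = -1}"
    \<comment> \<open>A discrete logarithm. It is determined only modulo \<open>p - 1\<close>, which
      is harmless because \<open>z ^ (p - 1) = 1\<close>.\<close>
    define ix where "ix a = (SOME k. [a = g ^ k] (mod int p))" for a
    have ix: "[a = g ^ ix a] (mod int p)" if "\<not> int p dvd a" for a
      unfolding ix_def using g(3)[OF that] by (rule someI_ex)
    define \<psi> where "\<psi> a = (if int p dvd a then 0 else z ^ ix a)" for a
    have z1: "z ^ (p - 1) = 1"
    proof -
      have "z ^ (p - 1) = z ^ (2 * ?h)" using h by (rule arg_cong)
      also have "\<dots> = (z ^ ?h)\<^sup>2" by (rule power_even_eq)
      also have "\<dots> = 1" using z by simp
      finally show ?thesis .
    qed
    have zcong: "z ^ i = z ^ j" if "[g ^ i = g ^ j] (mod int p)" for i j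
    proof -
      have "[i = j] (mod (p - 1))" using that g(4) by blast
      then have "i mod (p - 1) = j mod (p - 1)" by (simp add: cong_def)
      moreover have "z ^ n = z ^ (n mod (p - 1))" for n
        by (subst (1) div_mult_mod_eq[of n "p - 1", symmetric])
          (simp only: power_add power_mult mult.commute[of _ "p - 1"] z1, simp)
      ultimately show ?thesis by metis
    qed
    have \<psi>I: "\<psi> a = z ^ i" if "[a = g ^ i] (mod int p)" for a i
    proof -
      have "\<not> int p dvd g ^ i" using g(1) prime_p by (meson prime_dvd_power prime_nat_int_transfer)
      then have "\<not> int p dvd a" using that by (simp add: cong_dvd_iff)
      moreover have "[g ^ ix a = g ^ i] (mod int p)"
        using ix[OF \<open>\<not> int p dvd a\<close>] that by (metis cong_sym cong_trans)
      ultimately show ?thesis using zcong by (simp add: \<psi>_def)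
    qed
    have "z \<noteq> 0"
    proof
      assume "z = 0"
      then show False using z p_gt_2 h by (auto simp: power_0_left split: if_splits)
    qed
    have "\<psi> (a * b) = \<psi> a * \<psi> b" for a b
    proof (cases "int p dvd a * b")
      case True
      then show ?thesis by (auto simp: \<psi>_def dvd_mult_iff)
    next
      case False
      then have ab: "\<not> int p dvd a" "\<not> int p dvd b" by auto
      have "[a * b = g ^ (ix a + ix b)] (mod int p)"
        using ab[THEN ix] by (simp add: power_add cong_mult)
      from \<psi>I[OF this] show ?thesis using ab by (simp add: \<psi>_def power_add)
    qed
    moreover have "\<psi> (a + int p) = \<psi> a" for a
    proof (cases "int p dvd a")
      case False
      have "[a + int p = g ^ ix a] (mod int p)"
        using ix[OF False] by (simp add: cong_def)
      from \<psi>I[OF this] show ?thesis using False by (simp add: \<psi>_def)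
    qed (simp add: \<psi>_def)
    ultimately have "dirichlet_char p \<psi>"
      unfolding dirichlet_char_def coprime_iff using \<open>z \<noteq> 0\<close> by (auto simp: \<psi>_def)
    moreover have "\<psi> (-1) = -1" using \<psi>I[OF cong_sym[OF g(2)]] z by simp
    moreover have "\<psi> g = z" using \<psi>I[of g 1] by simp
    ultimately show "\<exists>\<psi>\<in>odd_chars p. z = \<psi> g" by (auto simp: odd_chars_def)
  qed
  then show thesis by (rule that)
qed

lemma finite_odd_chars: "finite (odd_chars p)"
  and card_odd_chars: "card (odd_chars p) = (p - 1) div 2"
proof -
  obtain g where g: "bij_betw (\<lambda>\<psi>. \<psi> g) (odd_chars p) {z. z ^ ((p - 1) div 2) = -1}"
    by (rule odd_chars_bij)
  have h: "(p - 1) div 2 > 0" using p_gt_2 by auto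
  then have "finite {z::complex. z ^ ((p - 1) div 2) = -1}"
    using card_nth_roots[of "-1" "(p - 1) div 2"] card_gt_0_iff by (metis zero_neq_neg_one)
  then show "finite (odd_chars p)" using g bij_betw_finite by blast
  show "card (odd_chars p) = (p - 1) div 2"
    using bij_betw_same_card[OF g] card_nth_roots[of "-1" "(p - 1) div 2"] h by simp
qed

end

subsection \<open>Lambert series\<close>

no_notation Infinite_Set_Sum.abs_summable_on (infix "abs'_summable'_on" 50)

section \<open>Unordered sums and their rearrangement\<close>

lemma has_sum_diff:
  fixes f g :: "'a \<Rightarrow> complex"
  assumes "(f has_sum a) A" "(g has_sum b) A"
  shows "((\<lambda>x. f x - g x) has_sum (a - b)) A"
  using has_sum_add[OF assms(1) has_sum_uminusI[OF assms(2)]] by simp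

text \<open>Turns a product of absolutely convergent series into a double series that may then be
  reindexed freely.\<close>

lemma has_sum_mult_times:
  fixes f :: "'a \<Rightarrow> complex" and g :: "'b \<Rightarrow> complex"
  assumes f: "f abs_summable_on A" and g: "g abs_summable_on B"
  shows "((\<lambda>(a, b). f a * g b) has_sum (infsum f A * infsum g B)) (A \<times> B)"
proof -
  have "(\<lambda>(a, b). f a * g b) abs_summable_on A \<times> B"
    unfolding Infinite_Sum.abs_summable_on_Sigma_iff
  proof (intro conjI ballI)
    show "(\<lambda>y. case (x, y) of (a, b) \<Rightarrow> f a * g b) abs_summable_on B" for x
      using summable_on_cmult_right[OF g, of "norm (f x)"] by (simp add: norm_mult)
    have "(\<lambda>x. norm (f x) * infsum (\<lambda>y. norm (g y)) B) abs_summable_on A"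
      using summable_on_cmult_left[OF f, of "infsum (\<lambda>y. norm (g y)) B"]
      by (simp add: norm_mult infsum_nonneg)
    then show "(\<lambda>x. infsum (\<lambda>y. norm (case (x, y) of (a, b) \<Rightarrow> f a * g b)) B) abs_summable_on A"
      by (simp add: norm_mult infsum_cmult_right')
  qed
  then show ?thesis
    by (intro has_sum_SigmaI[where g = "\<lambda>x. f x * infsum g B"])
      (auto intro!: has_sum_cmult_right has_sum_cmult_left has_sum_infsum abs_summable_summable
        f g[THEN abs_summable_summable])
qed

text \<open>The majorant for all two-sided series below; the linear factor leaves room for
  coefficients that grow linearly.\<close>

lemma summable_on_int_power:
  assumes "0 \<le> r" "r < 1"
  shows "(\<lambda>m::int. (1 + real_of_int \<bar>m\<bar>) * r ^ nat \<bar>m\<bar>) summable_on UNIV"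
proof -
  define f where "f n = (1 + real n) * r ^ n" for n
  have "summable f"
    using geometric_deriv_sums[of r] assms unfolding f_def
    by (auto simp: sums_iff add.commute)
  then have "f summable_on UNIV"
    using assms by (subst summable_on_UNIV_nonneg_real_iff) (auto simp: f_def)
  then have *: "f summable_on A" for A by (rule summable_on_subset_banach) auto
  let ?g = "\<lambda>m::int. f (nat \<bar>m\<bar>)"
  have "?g summable_on int ` UNIV" "?g summable_on (\<lambda>n. - int n) ` {1..}"
    using *[of UNIV] *[of "{1..}"] by (auto simp: summable_on_reindex inj_on_def o_def)
  moreover have "int ` UNIV \<inter> (\<lambda>n. - int n) ` {1..} = {}" by auto
  ultimately have "?g summable_on (int ` UNIV \<union> (\<lambda>n. - int n) ` {1..})"
    by (intro summable_on_Un_disjoint)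
  moreover have "int ` UNIV \<union> (\<lambda>n. - int n) ` {1..} = UNIV"
  proof -
    have "m \<in> int ` UNIV \<or> m \<in> (\<lambda>n. - int n) ` {1..}" for m
    proof (cases "m \<ge> 0")
      case True
      then show ?thesis by (metis nat_0_le rangeI)
    next
      case False
      then have "m = - int (nat (- m))" "nat (- m) \<in> {1..}" by auto
      then show ?thesis by blast
    qed
    then show ?thesis by auto
  qed
  ultimately show ?thesis by (simp add: f_def)
qed

lemma sums_infsum_int:
  fixes f :: "int \<Rightarrow> complex"
  assumes f: "f summable_on UNIV" and "f 0 = 0"
  shows "(\<lambda>n. f (int (Suc n)) + f (- int (Suc n))) sums infsum f UNIV"
proof -
  let ?A = "range (\<lambda>n. int (Suc n))" and ?B = "range (\<lambda>n. - int (Suc n))"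
  have hs: "(f has_sum infsum f A) A" for A
    by (rule has_sum_infsum[OF summable_on_subset_banach[OF f]]) simp
  have "((\<lambda>n. f (int (Suc n))) has_sum infsum f ?A) UNIV"
    "((\<lambda>n. f (- int (Suc n))) has_sum infsum f ?B) UNIV"
    using hs[of ?A] hs[of ?B] by (auto simp: has_sum_reindex inj_on_def o_def)
  then have "((\<lambda>n. f (int (Suc n)) + f (- int (Suc n))) has_sum (infsum f ?A + infsum f ?B)) UNIV"
    by (rule has_sum_add)
  moreover have "(f has_sum (infsum f ?A + infsum f ?B)) (?A \<union> ?B)"
    by (rule has_sum_Un_disjoint[OF hs hs]) auto
  moreover have "?A \<union> ?B = - {0}"
  proof -
    have "m \<in> ?A \<or> m \<in> ?B" if "m \<noteq> 0" for m
    proof (cases "m > 0")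
      case True
      then have "m = int (Suc (nat (m - 1)))" by simp
      then show ?thesis by blast
    next
      case False
      then have "m = - int (Suc (nat (- m - 1)))" using that by simp
      then show ?thesis by blast
    qed
    then show ?thesis by auto
  qed
  ultimately have "(f has_sum (infsum f ?A + infsum f ?B)) (- {0})" by simp
  then have "(f has_sum (infsum f ?A + infsum f ?B)) UNIV"
    using \<open>f 0 = 0\<close> by (subst has_sum_cong_neutral[where T = "- {0}" and g = f]) auto
  then have "infsum f UNIV = infsum f ?A + infsum f ?B" by (rule infsumI)
  then show ?thesis
    using has_sum_imp_sums[OF \<open>((\<lambda>n. f (int (Suc n)) + f (- int (Suc n))) has_sum _) UNIV\<close>] by simp
qed

lemma has_sum_supported_on_range:
  fixes f :: "'b \<Rightarrow> complex"
  assumes "inj h" "((\<lambda>a. f (h a)) has_sum S) UNIV" "\<And>b. b \<notin> range h \<Longrightarrow> f b = 0"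
  shows "(f has_sum S) UNIV"
proof -
  have "(f has_sum S) (range h)" using assms by (simp add: has_sum_reindex o_def)
  then show ?thesis using assms(3)
    by (subst has_sum_cong_neutral[where T = "range h" and g = f]) auto
qed

section \<open>Geometric and Lambert series\<close>

lemma has_sum_geometric_Suc:
  fixes w :: "'b :: {real_normed_field, banach}"
  assumes "norm w < 1"
  shows "((\<lambda>n. w ^ Suc n) has_sum (w / (1 - w))) UNIV"
  using has_sum_geometric_from_1[OF assms]
  by (subst has_sum_reindex_bij_witness[of _ "\<lambda>n. n - 1" "\<lambda>n. n + 1"]) auto

lemma has_sum_deriv_geometric_Suc:
  fixes w :: "'b :: {real_normed_field, banach}"
  assumes w: "norm w < 1"
  shows "((\<lambda>n. of_nat (Suc n) * w ^ Suc n) has_sum (w / (1 - w)\<^sup>2)) UNIV"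
proof -
  have "(\<lambda>n. norm w * (of_nat (Suc n) * norm w ^ n)) sums (norm w * (1 / (1 - norm w)\<^sup>2))"
    using w by (intro sums_mult geometric_deriv_sums) simp
  moreover have "(\<lambda>n. w * (of_nat (Suc n) * w ^ n)) sums (w * (1 / (1 - w)\<^sup>2))"
    using w by (intro sums_mult geometric_deriv_sums)
  ultimately show ?thesis
    by (intro norm_summable_imp_has_sum)
      (simp_all add: norm_mult norm_power sums_iff mult_ac del: of_nat_Suc)
qed

text \<open>Expanding each \<open>z^a / (1 - z^a)\<close> geometrically gives the double series of
  \<open>c a * z^(a b)\<close>, which converges absolutely because the coefficients grow at most
  linearly. Summing over \<open>a\<close> first turns the inner sum into the generating function
  \<open>f\<close> at \<open>z^b\<close>.\<close>

lemma
  fixes z :: complex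
  assumes z: "norm z < 1" and c: "\<And>n. norm (c n) \<le> real (Suc n)"
  defines "S \<equiv> (\<Sum>n. c n * (z ^ Suc n / (1 - z ^ Suc n)))"
  shows has_sum_lambert: "((\<lambda>n. c n * (z ^ Suc n / (1 - z ^ Suc n))) has_sum S) UNIV"
    and has_sum_lambert_swap: "\<And>f. (\<And>w. norm w < 1 \<Longrightarrow> ((\<lambda>n. c n * w ^ Suc n) has_sum f w) UNIV)
      \<Longrightarrow> ((\<lambda>n. f (z ^ Suc n)) has_sum S) UNIV"
proof -
  let ?t = "\<lambda>a b. c a * z ^ (Suc a * Suc b)"
  define r where "r = norm z"
  have r: "0 \<le> r" "r < 1" using z by (auto simp: r_def)
  have pow: "norm (z ^ Suc n) < 1" "r ^ Suc n \<le> r" "r ^ Suc n < 1" for n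
  proof -
    show "r ^ Suc n \<le> r" using r power_le_one[of r n] by (simp add: mult_left_le)
    then show "r ^ Suc n < 1" using r by simp
    then show "norm (z ^ Suc n) < 1" by (simp add: r_def norm_power norm_mult)
  qed
  \<comment> \<open>A common majorant for both sums: \<open>r ^ Suc n \<le> r\<close>, so every
    denominator \<open>1 - r ^ Suc n\<close> is at least \<open>1 - r\<close>.\<close>
  have lin: "(\<lambda>n. real (Suc n) * r ^ Suc n / (1 - r)) summable_on UNIV"
    using has_sum_divide_const[OF has_sum_deriv_geometric_Suc[of r], of "1 - r"] r
    by (auto dest: has_sum_imp_summable)
  have le: "norm (c n) * (r ^ Suc n / (1 - r ^ Suc n)) \<le> real (Suc n) * r ^ Suc n / (1 - r)" for n
  proof -
    have "norm (c n) * (r ^ Suc n / (1 - r ^ Suc n)) \<le> real (Suc n) * (r ^ Suc n / (1 - r))"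
      using r pow[of n] c[of n] by (intro mult_mono divide_left_mono mult_pos_pos divide_nonneg_nonneg) auto
    then show ?thesis by simp
  qed
  have S: "((\<lambda>n. c n * (z ^ Suc n / (1 - z ^ Suc n))) has_sum S) UNIV"
  proof -
    have "norm (c n * (z ^ Suc n / (1 - z ^ Suc n))) \<le> real (Suc n) * r ^ Suc n / (1 - r)" for n
    proof -
      have "1 - r ^ Suc n = 1 - norm (z ^ Suc n)" by (simp add: r_def norm_power norm_mult)
      also have "\<dots> \<le> norm (1 - z ^ Suc n)" by (metis norm_one norm_triangle_ineq2)
      finally have "norm (c n * (z ^ Suc n / (1 - z ^ Suc n))) \<le> norm (c n) * (r ^ Suc n / (1 - r ^ Suc n))"
        unfolding norm_divide norm_mult norm_power r_def[symmetric] using r pow(3)[of n]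
        by (intro mult_left_mono divide_left_mono mult_pos_pos) auto
      then show ?thesis using le[of n] by linarith
    qed
    from Infinite_Sum.abs_summable_on_comparison_test'[OF lin this]
    have "(\<lambda>n. c n * (z ^ Suc n / (1 - z ^ Suc n))) summable_on UNIV"
      by (rule abs_summable_summable)
    from has_sum_infsum[OF this] sums_unique[OF has_sum_imp_sums[OF has_sum_infsum[OF this]]]
    show ?thesis by (simp only: S_def)
  qed
  then show "((\<lambda>n. c n * (z ^ Suc n / (1 - z ^ Suc n))) has_sum S) UNIV" .
  have row: "((\<lambda>b. norm (?t a b)) has_sum (norm (c a) * (r ^ Suc a / (1 - r ^ Suc a)))) UNIV" for a
  proof -
    have "norm (r ^ Suc a) < 1" using pow(3)[of a] r by simp
    moreover have "norm (?t a b) = norm (c a) * (r ^ Suc a) ^ Suc b" for b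
      by (simp only: norm_mult norm_power r_def power_mult)
    ultimately show ?thesis
      using has_sum_cmult_right[OF has_sum_geometric_Suc, of "r ^ Suc a" "norm (c a)"] by simp
  qed
  have "(\<lambda>(a, b). ?t a b) abs_summable_on UNIV \<times> UNIV"
    unfolding Infinite_Sum.abs_summable_on_Sigma_iff
  proof (intro conjI ballI)
    show "(\<lambda>y. case (a, y) of (a, b) \<Rightarrow> ?t a b) abs_summable_on UNIV" for a
      using row[of a, THEN has_sum_imp_summable] by simp
    show "(\<lambda>x. infsum (\<lambda>y. norm (case (x, y) of (a, b) \<Rightarrow> ?t a b)) UNIV) abs_summable_on UNIV"
    proof (rule Infinite_Sum.abs_summable_on_comparison_test'[OF lin])
      show "norm (infsum (\<lambda>y. norm (case (a, y) of (a, b) \<Rightarrow> ?t a b)) UNIV)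
          \<le> real (Suc a) * r ^ Suc a / (1 - r)" for a
      proof -
        have "0 \<le> norm (c a) * (r ^ Suc a / (1 - r ^ Suc a))"
          using pow(3)[of a] r by (intro mult_nonneg_nonneg divide_nonneg_nonneg) auto
        then show ?thesis
          using le[of a] by (simp only: prod.case infsumI[OF row] real_norm_def abs_of_nonneg)
      qed
    qed
  qed
  from has_sum_infsum[OF abs_summable_summable[OF this]]
  obtain T where T: "((\<lambda>(a, b). ?t a b) has_sum T) (UNIV \<times> UNIV)" ..
  have "((\<lambda>a. c a * (z ^ Suc a / (1 - z ^ Suc a))) has_sum T) UNIV"
  proof (rule has_sum_SigmaD[OF T])
    show "((\<lambda>b. case (a, b) of (a, b) \<Rightarrow> ?t a b) has_sum (c a * (z ^ Suc a / (1 - z ^ Suc a)))) UNIV" for a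
      using has_sum_cmult_right[OF has_sum_geometric_Suc[OF pow(1)[of a]], of "c a"]
      by (simp only: prod.case power_mult)
  qed
  with S have "T = S" by (metis has_sum_unique)
  have T': "((\<lambda>(b, a). ?t a b) has_sum S) (UNIV \<times> UNIV)"
    using T unfolding \<open>T = S\<close>
    by (subst has_sum_reindex_bij_witness[where i = prod.swap and j = prod.swap and h = "\<lambda>(a, b). ?t a b"]) auto
  fix f assume f: "\<And>w. norm w < 1 \<Longrightarrow> ((\<lambda>n. c n * w ^ Suc n) has_sum f w) UNIV"
  show "((\<lambda>n. f (z ^ Suc n)) has_sum S) UNIV"
  proof (rule has_sum_SigmaD[OF T'])
    show "((\<lambda>a. case (b, a) of (b, a) \<Rightarrow> ?t a b) has_sum f (z ^ Suc b)) UNIV" for b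
      using f[OF pow(1)[of b]] by (simp only: prod.case power_mult[symmetric] mult.commute[of "Suc b"])
  qed
qed

text \<open>For \<open>norm z < 1\<close> this is the sum of \<open>sigma(n) z^n\<close>, so
  \<open>1 - 24 * lambert1 z\<close> is the quasimodular Eisenstein series of weight 2.\<close>

definition lambert1 :: "complex \<Rightarrow> complex" where
  "lambert1 z = (\<Sum>n. of_nat (Suc n) * (z ^ Suc n / (1 - z ^ Suc n)))"

lemma has_sum_lambert1:
  assumes "norm z < 1"
  shows "((\<lambda>n. of_nat (Suc n) * (z ^ Suc n / (1 - z ^ Suc n))) has_sum lambert1 z) UNIV"
    and "((\<lambda>n. z ^ Suc n / (1 - z ^ Suc n)\<^sup>2) has_sum lambert1 z) UNIV"
proof -
  have c: "norm (of_nat (Suc n) :: complex) \<le> real (Suc n)" for n by (simp only: norm_of_nat order_refl)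
  show "((\<lambda>n. of_nat (Suc n) * (z ^ Suc n / (1 - z ^ Suc n))) has_sum lambert1 z) UNIV"
    unfolding lambert1_def by (rule has_sum_lambert[OF assms c])
  show "((\<lambda>n. z ^ Suc n / (1 - z ^ Suc n)\<^sup>2) has_sum lambert1 z) UNIV"
    unfolding lambert1_def by (rule has_sum_lambert_swap[OF assms c has_sum_deriv_geometric_Suc])
qed

section \<open>The coefficients 1 / (1 - Q^m)\<close>

locale nome =
  fixes Q :: complex
  assumes Q_nonzero: "Q \<noteq> 0" and norm_Q: "norm Q < 1"
begin

text \<open>Note that \<open>u 0 = 0\<close>, so that sums over the nonzero integers may be taken over all integers.\<close>

definition u :: "int \<Rightarrow> complex" where "u m = 1 / (1 - Q powi m)"

lemma u_0 [simp]: "u 0 = 0" by (simp add: u_def)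

lemma norm_Q_power: "n > 0 \<Longrightarrow> norm (Q ^ n) \<le> norm Q" "n > 0 \<Longrightarrow> norm (Q ^ n) < 1"
proof -
  assume "n > 0"
  then show "norm (Q ^ n) \<le> norm Q" using norm_Q power_decreasing[of 1 n "norm Q"] by (simp add: norm_power)
  then show "norm (Q ^ n) < 1" using norm_Q by simp
qed

lemma Q_powi_neq_1: "m \<noteq> 0 \<Longrightarrow> Q powi m \<noteq> 1"
proof -
  have *: "Q ^ n \<noteq> 1" if "n > 0" for n using norm_Q_power(2)[OF that] by auto
  assume "m \<noteq> 0"
  then show ?thesis using *[of "nat m"] *[of "nat (- m)"]
    by (cases "m > 0") (auto simp: power_int_def power_inverse)
qed

lemma u_minus: "m \<noteq> 0 \<Longrightarrow> u (- m) = 1 - u m"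
  using Q_powi_neq_1[of m] Q_nonzero by (simp add: u_def power_int_minus field_simps)

lemma u_mult_Q: "u m * Q powi m = - u (- m)"
  using Q_powi_neq_1[of m] u_minus[of m] by (cases "m = 0") (auto simp: u_def field_simps)

lemma u_mult:
  assumes "m \<noteq> 0" "n \<noteq> 0" "m + n \<noteq> 0"
  shows "u m * u n = u (m + n) * (u m + u n - 1)"
proof -
  have "Q powi (m + n) = Q powi m * Q powi n" using Q_nonzero by (simp add: power_int_add)
  then show ?thesis
    using assms[THEN Q_powi_neq_1] by (simp add: u_def divide_simps) (simp add: algebra_simps)
qed

text \<open>For positive \<open>m\<close> the denominator has norm at least
  \<open>1 - norm Q\<close>; negative indices reduce to positive ones by \<open>u_mult_Q\<close>,
  which only adds a factor of norm below 1.\<close>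

lemma norm_u_le: "norm (u m) \<le> 1 / (1 - norm Q)"
proof (cases m "0 :: int" rule: linorder_cases)
  case greater
  define n where "n = nat m"
  have n: "n > 0" "m = int n" using greater by (auto simp: n_def)
  have "1 - norm Q \<le> 1 - norm (Q ^ n)" using norm_Q_power(1)[of n] n by simp
  also have "\<dots> \<le> norm (1 - Q ^ n)" by (metis norm_one norm_triangle_ineq2)
  finally show ?thesis using norm_Q by (simp add: u_def n norm_divide frac_le)
next
  case less
  define n where "n = nat (- m)"
  have n: "n > 0" "m = - int n" using less by (auto simp: n_def)
  have "1 - norm Q \<le> 1 - norm (Q ^ n)" using norm_Q_power(1)[of n] n by simp
  also have "\<dots> \<le> norm (1 - Q ^ n)" by (metis norm_one norm_triangle_ineq2)
  finally have *: "norm (u (int n)) \<le> 1 / (1 - norm Q)" using norm_Q by (simp add: u_def norm_divide frac_le)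
  have "norm (u m) = norm (u (int n)) * norm (Q ^ n)"
    using u_mult_Q[of "int n"] by (simp add: n) (metis norm_minus_cancel norm_mult)
  also have "\<dots> \<le> 1 / (1 - norm Q) * 1"
    using * norm_Q_power(2)[of n] n norm_Q by (intro mult_mono) auto
  finally show ?thesis by simp
qed (use norm_Q in simp)

section \<open>Laurent series on the annulus\<close>

text \<open>The domain of convergence of the series with coefficients \<open>u m\<close>: these tend
  to 1 as \<open>m\<close> grows and behave like \<open>- Q^n\<close> at
  \<open>m = - n\<close>.\<close>

definition annulus :: "complex set" where "annulus = {x. norm Q < norm x \<and> norm x < 1}"

lemma annulus_nonzero: "x \<in> annulus \<Longrightarrow> x \<noteq> 0"
  by (auto simp: annulus_def)

lemma annulus_reflect: "x \<in> annulus \<Longrightarrow> Q / x \<in> annulus"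
  using annulus_nonzero[of x] Q_nonzero norm_Q
  by (auto simp: annulus_def norm_divide divide_simps mult_less_cancel_left1)

text \<open>Terms of negative index become terms of positive index at the reflected point, since
  \<open>u m * x powi m = - u (- m) * (Q / x) powi (- m)\<close>. The rate is therefore the larger
  of the norms of \<open>x\<close> and \<open>Q / x\<close>.\<close>

lemma norm_u_powi_le:
  assumes "x \<in> annulus"
  obtains C r where "C > 0" "0 \<le> r" "r < 1" "\<And>m. norm (u m * x powi m) \<le> C * r ^ nat \<bar>m\<bar>"
proof
  define C where "C = 1 / (1 - norm Q)"
  define r where "r = max (norm x) (norm (Q / x))"
  show "C > 0" using norm_Q by (simp add: C_def)
  show "0 \<le> r" by (simp add: r_def le_max_iff_disj)
  show "r < 1" using assms annulus_reflect[OF assms] by (simp add: r_def annulus_def)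
  show "norm (u m * x powi m) \<le> C * r ^ nat \<bar>m\<bar>" for m
  proof (cases "m \<ge> 0")
    case True
    have "norm (u m * x powi m) = norm (u m) * norm x ^ nat m"
      using True by (simp add: norm_mult power_int_def norm_power)
    also have "\<dots> \<le> C * r ^ nat m"
      unfolding C_def r_def using norm_Q by (intro mult_mono norm_u_le power_mono) auto
    finally show ?thesis using True by simp
  next
    case False
    have "u m * x powi m = - (u (- m) * (Q / x) powi (- m))"
      using u_mult_Q[of "- m"] annulus_nonzero[OF assms] Q_nonzero
      by (simp add: power_int_divide_distrib power_int_minus divide_simps)
    then have "norm (u m * x powi m) = norm (u (- m)) * norm (Q / x) ^ nat (- m)"
      using False by (simp add: norm_mult power_int_def norm_power)
    also have "\<dots> \<le> C * r ^ nat (- m)"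
      unfolding C_def r_def using norm_Q by (intro mult_mono norm_u_le power_mono) auto
    finally show ?thesis using False by simp
  qed
qed

lemma abs_summable_linear_coeff:
  assumes x: "x \<in> annulus" and c: "\<And>m. norm (c m) \<le> K * (1 + real_of_int \<bar>m\<bar>)" and K: "K \<ge> 0"
  shows "(\<lambda>m. c m * u m * x powi m) abs_summable_on UNIV"
proof -
  obtain C r where C: "C > 0" "0 \<le> r" "r < 1" "\<And>m. norm (u m * x powi m) \<le> C * r ^ nat \<bar>m\<bar>"
    using norm_u_powi_le[OF x] by blast
  show ?thesis
  proof (rule Infinite_Sum.abs_summable_on_comparison_test')
    show "(\<lambda>m. K * C * ((1 + real_of_int \<bar>m\<bar>) * r ^ nat \<bar>m\<bar>)) summable_on UNIV"
      by (intro summable_on_cmult_right summable_on_int_power C)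
    fix m
    have "norm (c m * u m * x powi m) = norm (c m) * norm (u m * x powi m)"
      by (simp add: norm_mult)
    also have "\<dots> \<le> (K * (1 + real_of_int \<bar>m\<bar>)) * (C * r ^ nat \<bar>m\<bar>)"
      using K by (intro mult_mono c C(4)) auto
    finally show "norm (c m * u m * x powi m) \<le> K * C * ((1 + real_of_int \<bar>m\<bar>) * r ^ nat \<bar>m\<bar>)"
      by (simp add: mult_ac)
  qed
qed

text \<open>Up to normalization and affine terms \<open>F\<close> is the Weierstrass zeta function
  in the multiplicative variable. \<open>D\<close> is the termwise derivative \<open>x * F'\<close>,
  the counterpart of the pe function, and \<open>G\<close> is auxiliary: it cancels in
  \<open>F_relation\<close>.\<close>

definition F where "F x = (\<Sum>\<^sub>\<infinity>m. u m * x powi m)"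
definition G where "G x = (\<Sum>\<^sub>\<infinity>m. (u m)\<^sup>2 * x powi m)"
definition D where "D x = (\<Sum>\<^sub>\<infinity>m. of_int m * u m * x powi m)"

lemma summable_F: "x \<in> annulus \<Longrightarrow> (\<lambda>m. u m * x powi m) abs_summable_on UNIV"
  using abs_summable_linear_coeff[of x "\<lambda>_. 1" 1] by simp

lemma summable_G: "x \<in> annulus \<Longrightarrow> (\<lambda>m. (u m)\<^sup>2 * x powi m) abs_summable_on UNIV"
proof -
  assume x: "x \<in> annulus"
  have "norm (u m) \<le> 1 / (1 - norm Q) * (1 + real_of_int \<bar>m\<bar>)" for m
    using mult_mono[OF norm_u_le[of m], of 1 "1 + real_of_int \<bar>m\<bar>"] norm_Q by simp
  from abs_summable_linear_coeff[OF x this] norm_Q show ?thesis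
    by (simp add: power2_eq_square)
qed

lemma summable_D: "x \<in> annulus \<Longrightarrow> (\<lambda>m. of_int m * u m * x powi m) abs_summable_on UNIV"
  using abs_summable_linear_coeff[of x of_int 1] by simp

lemmas has_sum_F = has_sum_infsum[OF abs_summable_summable[OF summable_F], folded F_def]
lemmas has_sum_G = has_sum_infsum[OF abs_summable_summable[OF summable_G], folded G_def]
lemmas has_sum_D = has_sum_infsum[OF abs_summable_summable[OF summable_D], folded D_def]

lemma F_reflect: "x \<in> annulus \<Longrightarrow> F (Q / x) = - F x"
proof -
  assume x: "x \<in> annulus"
  have "F (Q / x) = (\<Sum>\<^sub>\<infinity>m. - (u m * x powi m))"
    unfolding F_def
  proof (rule infsum_reindex_bij_witness[where i = uminus and j = uminus])
    fix m show "- (u (- m) * x powi (- m)) = u m * (Q / x) powi m"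
      using u_mult_Q[of m] annulus_nonzero[OF x] Q_nonzero
      by (simp add: power_int_divide_distrib power_int_minus divide_simps)
  qed auto
  then show ?thesis by (simp add: infsum_uminus F_def)
qed

lemma D_reflect: "x \<in> annulus \<Longrightarrow> D (Q / x) = D x"
proof -
  assume x: "x \<in> annulus"
  show ?thesis unfolding D_def
  proof (rule infsum_reindex_bij_witness[where i = uminus and j = uminus])
    fix m show "of_int (- m) * u (- m) * x powi (- m) = of_int m * u m * (Q / x) powi m"
      using u_mult_Q[of m] annulus_nonzero[OF x] Q_nonzero
      by (simp add: power_int_divide_distrib power_int_minus divide_simps) (simp add: mult.assoc)
  qed auto
qed

text \<open>All products are written as double series in \<open>x^M * y^N\<close>. Off the lines
  \<open>M = 0\<close>, \<open>N = 0\<close> and \<open>M = N\<close> the coefficients cancel by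
  \<open>u_mult\<close>; the three lines contribute the single series on the right.\<close>

lemma F_mult:
  assumes x: "x \<in> annulus" and y: "y \<in> annulus" and xy: "x * y \<in> annulus"
  shows "F x * F y - F (x * y) * (F x + F y) = G (x * y) + G x + G y - F x - F y"
proof -
  note nz = annulus_nonzero[OF x] annulus_nonzero[OF y]
  let ?t = "\<lambda>M N. x powi M * y powi N"
  have 1: "((\<lambda>(M, N). u M * u N * ?t M N) has_sum F x * F y) (UNIV \<times> UNIV)"
    using has_sum_mult_times[OF summable_F[OF x] summable_F[OF y]]
    by (simp add: F_def mult_ac)
  have "((\<lambda>(s, m). u s * (x * y) powi s * (u m * x powi m)) has_sum F (x * y) * F x) (UNIV \<times> UNIV)"
    using has_sum_mult_times[OF summable_F[OF xy] summable_F[OF x]] by (simp add: F_def)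
  \<comment> \<open>Since \<open>(x * y)^s * x^m = x^(m + s) * y^s\<close>, the new indices are
    \<open>M = m + s\<close> and \<open>N = s\<close>.\<close>
  then have 2: "((\<lambda>(M, N). u N * u (M - N) * ?t M N) has_sum F (x * y) * F x) (UNIV \<times> UNIV)"
    by (rule has_sum_reindex_bij_witness[where j = "\<lambda>(s, m). (m + s, s)" and i = "\<lambda>(M, N). (N, M - N)",
        THEN iffD1, rotated -1])
      (auto simp: power_int_add power_int_mult_distrib nz)
  have "((\<lambda>(s, m). u s * (x * y) powi s * (u m * y powi m)) has_sum F (x * y) * F y) (UNIV \<times> UNIV)"
    using has_sum_mult_times[OF summable_F[OF xy] summable_F[OF y]] by (simp add: F_def)
  then have 3: "((\<lambda>(M, N). u M * u (N - M) * ?t M N) has_sum F (x * y) * F y) (UNIV \<times> UNIV)"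
    by (rule has_sum_reindex_bij_witness[where j = "\<lambda>(s, m). (s, m + s)" and i = "\<lambda>(M, N). (M, N - M)",
        THEN iffD1, rotated -1])
      (auto simp: power_int_add power_int_mult_distrib nz)
  have u_u_minus: "u m * u (- m) = u m - (u m)\<^sup>2" for m
    by (cases "m = 0") (auto simp: u_minus power2_eq_square algebra_simps)
  have FG: "((\<lambda>m. u m * u (- m) * z powi m) has_sum (F z - G z)) UNIV" if "z \<in> annulus" for z
    unfolding u_u_minus left_diff_distrib using that by (intro has_sum_diff has_sum_F has_sum_G)
  have 4: "((\<lambda>(M, N). if M = N then (u M)\<^sup>2 * ?t M N else 0) has_sum G (x * y)) (UNIV \<times> UNIV)"
    unfolding UNIV_Times_UNIV
    by (rule has_sum_supported_on_range[where h = "\<lambda>m. (m, m)"])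
      (use has_sum_G[OF xy] in \<open>auto simp: inj_on_def power_int_mult_distrib mult_ac\<close>)
  have 5: "((\<lambda>(M, N). if M = 0 then u N * u (- N) * ?t M N else 0) has_sum (F y - G y)) (UNIV \<times> UNIV)"
    unfolding UNIV_Times_UNIV
    by (rule has_sum_supported_on_range[where h = "\<lambda>m. (0, m)"])
      (use FG[OF y] in \<open>auto simp: inj_on_def\<close>)
  have 6: "((\<lambda>(M, N). if N = 0 then u M * u (- M) * ?t M N else 0) has_sum (F x - G x)) (UNIV \<times> UNIV)"
    unfolding UNIV_Times_UNIV
    by (rule has_sum_supported_on_range[where h = "\<lambda>m. (m, 0)"])
      (use FG[OF x] in \<open>auto simp: inj_on_def\<close>)
  \<comment> \<open>On the exceptional lines the convention \<open>u 0 = 0\<close> removes one or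
    more of the products, and what is left is the stated correction.\<close>
  have coeff: "u M * u N - u N * u (M - N) - u M * u (N - M) =
      (if M = N then (u M)\<^sup>2 else 0) - (if M = 0 then u N * u (- N) else 0) - (if N = 0 then u M * u (- M) else 0)"
    for M N
  proof (cases "M = 0 \<or> N = 0 \<or> M = N")
    case False
    then have "u N * u (M - N) = u M * u N + u M * u (M - N) - u M"
      using u_mult[of N "M - N"] by (simp add: algebra_simps)
    moreover have "u M * u (N - M) = u M - u M * u (M - N)"
      using u_minus[of "M - N"] False by (simp add: right_diff_distrib)
    ultimately show ?thesis using False by simp
  qed (auto simp: power2_eq_square)
  have "((\<lambda>(M, N). u M * u N * ?t M N - u N * u (M - N) * ?t M N - u M * u (N - M) * ?t M N)
     has_sum (F x * F y - F (x * y) * F x - F (x * y) * F y)) (UNIV \<times> UNIV)"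
    using has_sum_diff[OF has_sum_diff[OF 1 2] 3] by (simp add: case_prod_unfold)
  moreover have "((\<lambda>(M, N). u M * u N * ?t M N - u N * u (M - N) * ?t M N - u M * u (N - M) * ?t M N)
     has_sum (G (x * y) - (F y - G y) - (F x - G x))) (UNIV \<times> UNIV)"
  proof -
    have "(\<lambda>(M, N). u M * u N * ?t M N - u N * u (M - N) * ?t M N - u M * u (N - M) * ?t M N) =
      (\<lambda>(M, N). (if M = N then (u M)\<^sup>2 * ?t M N else 0) - (if M = 0 then u N * u (- N) * ?t M N else 0)
          - (if N = 0 then u M * u (- M) * ?t M N else 0))"
    proof (intro ext, clarify)
      fix M N
      have "u M * u N * ?t M N - u N * u (M - N) * ?t M N - u M * u (N - M) * ?t M N =
        (u M * u N - u N * u (M - N) - u M * u (N - M)) * ?t M N" by (simp add: algebra_simps)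
      also have "\<dots> = (if M = N then (u M)\<^sup>2 * ?t M N else 0) - (if M = 0 then u N * u (- N) * ?t M N else 0)
          - (if N = 0 then u M * u (- M) * ?t M N else 0)"
        unfolding coeff by (simp add: algebra_simps)
      finally show "u M * u N * ?t M N - u N * u (M - N) * ?t M N - u M * u (N - M) * ?t M N = \<dots>" .
    qed
    then show ?thesis using has_sum_diff[OF has_sum_diff[OF 4 5] 6] by (simp add: case_prod_unfold)
  qed
  ultimately have "F x * F y - F (x * y) * F x - F (x * y) * F y = G (x * y) - (F y - G y) - (F x - G x)"
    by (rule has_sum_unique)
  then show ?thesis by (simp add: algebra_simps)
qed

section \<open>Convolutions of coefficients and the square of F\<close>

text \<open>The sequence \<open>u\<close> is not summable, as it tends to 1 at plus infinity.
  Subtracting the unit step makes it summable, so that part of the difference sums to 0 by shift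
  invariance, while the step and its shift differ by a signed count of \<open>s\<close>
  integers.\<close>

lemma has_sum_u_shift: "((\<lambda>m. u m - u (m - s)) has_sum of_int s) UNIV"
proof -
  define w where "w m = u m - of_bool (m > 0)" for m
  define C where "C = 1 / (1 - norm Q)"
  have C: "C > 0" using norm_Q by (simp add: C_def)
  have w_le: "norm (w m) \<le> C * ((1 + real_of_int \<bar>m\<bar>) * norm Q ^ nat \<bar>m\<bar>)" for m
  proof -
    have "norm (w m) \<le> norm (u \<bar>m\<bar>) * norm Q ^ nat \<bar>m\<bar>"
    proof (cases m "0 :: int" rule: linorder_cases)
      case greater
      then have "w m = u \<bar>m\<bar> * Q powi \<bar>m\<bar>"
        using u_mult_Q[of m] u_minus[of m] by (simp add: w_def)
      then show ?thesis by (simp add: norm_mult norm_power power_int_def)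
    next
      case less
      then have "w m = - (u \<bar>m\<bar> * Q powi \<bar>m\<bar>)"
        using u_mult_Q[of "- m"] by (simp add: w_def)
      then show ?thesis by (simp add: norm_mult norm_power power_int_def)
    qed (simp add: w_def)
    also have "\<dots> \<le> C * (1 * norm Q ^ nat \<bar>m\<bar>)"
      unfolding C_def mult_1_left by (intro mult_right_mono norm_u_le) auto
    also have "\<dots> \<le> C * ((1 + real_of_int \<bar>m\<bar>) * norm Q ^ nat \<bar>m\<bar>)"
      using C by (intro mult_left_mono mult_right_mono) auto
    finally show ?thesis .
  qed
  have "(\<lambda>m. C * ((1 + real_of_int \<bar>m\<bar>) * norm Q ^ nat \<bar>m\<bar>)) summable_on UNIV"
    using norm_Q by (intro summable_on_cmult_right summable_on_int_power) auto
  from Infinite_Sum.abs_summable_on_comparison_test'[OF this w_le] have "w summable_on UNIV"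
    by (rule abs_summable_summable)
  then have w: "(w has_sum infsum w UNIV) UNIV" by (rule has_sum_infsum)
  moreover have "((\<lambda>m. w (m - s)) has_sum infsum w UNIV) UNIV"
    using w by (subst has_sum_reindex_bij_witness[where i = "\<lambda>m. m + s" and j = "\<lambda>m. m - s" and h = w]) auto
  ultimately have "((\<lambda>m. w m - w (m - s)) has_sum (infsum w UNIV - infsum w UNIV)) UNIV"
    by (rule has_sum_diff)
  moreover have "((\<lambda>m. of_bool (m > 0) - of_bool (m - s > 0) :: complex) has_sum of_int s) UNIV"
  proof (rule has_sum_finite_neutralI)
    show "finite {min 0 s<..max 0 s}" by simp
    show "of_int s = (\<Sum>m\<in>{min 0 s<..max 0 s}. of_bool (m > 0) - of_bool (m - s > 0) :: complex)"
    proof (cases "s \<ge> 0")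
      case True
      then have "(\<Sum>m\<in>{min 0 s<..max 0 s}. of_bool (m > 0) - of_bool (m - s > 0) :: complex) = (\<Sum>m\<in>{0<..s}. 1)"
        by (intro sum.cong) auto
      then show ?thesis using True by simp
    next
      case False
      then have "(\<Sum>m\<in>{min 0 s<..max 0 s}. of_bool (m > 0) - of_bool (m - s > 0) :: complex) = (\<Sum>m\<in>{s<..0}. - 1)"
        by (intro sum.cong) auto
      then show ?thesis using False by simp
    qed
  qed (auto simp: min_def max_def split: if_splits)
  ultimately have "((\<lambda>m. (w m - w (m - s)) + (of_bool (m > 0) - of_bool (m - s > 0))) has_sum
      (infsum w UNIV - infsum w UNIV + of_int s)) UNIV"
    by (rule has_sum_add)
  then show ?thesis by (simp add: w_def algebra_simps)
qed

text \<open>The terms are even in \<open>m\<close> and equal \<open>- Q^n / (1 - Q^n)^2\<close> for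
  \<open>n = \<bar>m\<bar> > 0\<close>, so each positive index counts twice. This is where the
  weight 2 constant enters.\<close>

lemma has_sum_u_u_minus: "((\<lambda>m. u m * u (- m)) has_sum (- 2 * lambert1 Q)) UNIV"
proof -
  define C where "C = 1 / (1 - norm Q)"
  have C: "C > 0" using norm_Q by (simp add: C_def)
  have even: "u m * u (- m) = - (u \<bar>m\<bar> * u \<bar>m\<bar> * Q ^ nat \<bar>m\<bar>)" for m
    using u_mult_Q[of "\<bar>m\<bar>"] by (cases "m \<ge> 0") (auto simp: power_int_def mult.assoc)
  have le: "norm (u m * u (- m)) \<le> C * C * ((1 + real_of_int \<bar>m\<bar>) * norm Q ^ nat \<bar>m\<bar>)" for m
  proof -
    have "norm (u m * u (- m)) = norm (u \<bar>m\<bar>) * norm (u \<bar>m\<bar>) * (1 * norm Q ^ nat \<bar>m\<bar>)"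
      unfolding even by (simp add: norm_mult norm_power)
    also have "\<dots> \<le> C * C * ((1 + real_of_int \<bar>m\<bar>) * norm Q ^ nat \<bar>m\<bar>)"
      using C unfolding C_def by (intro mult_mono norm_u_le) auto
    finally show ?thesis .
  qed
  have "(\<lambda>m. C * C * ((1 + real_of_int \<bar>m\<bar>) * norm Q ^ nat \<bar>m\<bar>)) summable_on UNIV"
    using norm_Q by (intro summable_on_cmult_right summable_on_int_power) auto
  from Infinite_Sum.abs_summable_on_comparison_test'[OF this le]
  have sum: "(\<lambda>m. u m * u (- m)) summable_on UNIV" by (rule abs_summable_summable)
  have "u (int (Suc n)) * u (- int (Suc n)) + u (- int (Suc n)) * u (- (- int (Suc n)))
      = - 2 * (Q ^ Suc n / (1 - Q ^ Suc n)\<^sup>2)" for n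
  proof -
    have "u (int (Suc n)) * u (- int (Suc n)) = - (Q ^ Suc n / (1 - Q ^ Suc n)\<^sup>2)"
      unfolding even by (simp add: u_def power2_eq_square del: of_nat_Suc power_Suc)
    then show ?thesis unfolding minus_minus mult.commute[of "u (- int (Suc n))"] by simp
  qed
  then have "(\<lambda>n. - 2 * (Q ^ Suc n / (1 - Q ^ Suc n)\<^sup>2)) sums (\<Sum>\<^sub>\<infinity>m. u m * u (- m))"
    using sums_infsum_int[OF sum] by (simp only: u_0 mult_zero_left)
  moreover have "(\<lambda>n. - 2 * (Q ^ Suc n / (1 - Q ^ Suc n)\<^sup>2)) sums (- 2 * lambert1 Q)"
    by (rule has_sum_imp_sums[OF has_sum_cmult_right[OF has_sum_lambert1(2)[OF norm_Q]]])
  ultimately have "(\<Sum>\<^sub>\<infinity>m. u m * u (- m)) = - 2 * lambert1 Q" by (rule sums_unique2)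
  then show ?thesis using has_sum_infsum[OF sum] by simp
qed

lemma has_sum_u_convolution:
  assumes "s \<noteq> 0"
  shows "((\<lambda>m. u m * u (s - m)) has_sum (u s * (of_int s + 1 - 2 * u s))) UNIV"
proof -
  have pt: "((\<lambda>m. if m = a then c else 0) has_sum c) UNIV" for a :: int and c :: complex
    by (rule has_sum_finite_neutralI[where B = "{a}"]) auto
  \<comment> \<open>By \<open>u_mult\<close> and \<open>u_minus\<close> the product is
    \<open>u s * (u m - u (m - s))\<close> for \<open>m\<close> other than 0 and \<open>s\<close>.
    At these two indices the product is 0 by convention, and the two point masses correct for
    it.\<close>
  have "((\<lambda>m. u s * (u m - u (m - s)) + ((if m = 0 then u s * u (- s) else 0) - (if m = s then u s * u s else 0)))
      has_sum (u s * of_int s + (u s * u (- s) - u s * u s))) UNIV"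
    by (intro has_sum_add has_sum_diff pt has_sum_cmult_right has_sum_u_shift)
  moreover have "u s * (u m - u (m - s)) + ((if m = 0 then u s * u (- s) else 0) - (if m = s then u s * u s else 0))
      = u m * u (s - m)" for m
  proof (cases "m = 0 \<or> m = s")
    case False
    then show ?thesis using u_mult[of m "s - m"] u_minus[of "m - s"] assms by simp
  qed (use assms in auto)
  ultimately show ?thesis using u_minus[OF assms] by (simp add: algebra_simps)
qed

text \<open>In the Cauchy square the coefficient of \<open>x^s\<close> is a convolution: index
  \<open>s = 0\<close> gives the constant, and the others split into the coefficients of
  \<open>D\<close>, \<open>F\<close> and \<open>G\<close>.\<close>

lemma F_power2:
  assumes x: "x \<in> annulus"
  shows "(F x)\<^sup>2 = D x + F x - 2 * G x - 2 * lambert1 Q"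
proof -
  let ?k = "\<lambda>s. if s = 0 then (- 2 * lambert1 Q) else u s * (of_int s + 1 - 2 * u s)"
  have "((\<lambda>(m, n). u m * x powi m * (u n * x powi n)) has_sum F x * F x) (UNIV \<times> UNIV)"
    using has_sum_mult_times[OF summable_F[OF x] summable_F[OF x]] by (simp add: F_def)
  then have *: "((\<lambda>(s, m). x powi s * (u m * u (s - m))) has_sum F x * F x) (UNIV \<times> UNIV)"
    by (rule has_sum_reindex_bij_witness[where j = "\<lambda>(m, n). (m + n, m)" and i = "\<lambda>(s, m). (m, s - m)",
        THEN iffD1, rotated -1])
      (auto simp: power_int_add annulus_nonzero[OF x])
  have inner: "((\<lambda>m. u m * u (s - m)) has_sum ?k s) UNIV" for s
  proof (cases "s = 0")
    case True
    then show ?thesis using has_sum_u_u_minus by simp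
  qed (use has_sum_u_convolution in simp)
  have "((\<lambda>s. x powi s * ?k s) has_sum F x * F x) UNIV"
    by (rule has_sum_SigmaD[OF *]) (simp only: prod.case has_sum_cmult_right[OF inner])
  moreover have "((\<lambda>s. of_int s * u s * x powi s + u s * x powi s - 2 * ((u s)\<^sup>2 * x powi s)
       + (if s = 0 then (- 2 * lambert1 Q) else 0))
     has_sum (D x + F x - 2 * G x + (- 2 * lambert1 Q))) UNIV"
    by (intro has_sum_add has_sum_diff has_sum_cmult_right has_sum_D has_sum_F has_sum_G x
        has_sum_finite_neutralI[where B = "{0}"]) auto
  moreover have "of_int s * u s * x powi s + u s * x powi s - 2 * ((u s)\<^sup>2 * x powi s)
       + (if s = 0 then (- 2 * lambert1 Q) else 0) = x powi s * ?k s" for s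
    by (simp add: power2_eq_square algebra_simps)
  ultimately show ?thesis by (simp add: power2_eq_square has_sum_unique)
qed

text \<open>The \<open>G\<close> terms of the three squares cancel against those of the mixed
  products, and the shift by \<open>1 / 2\<close> is what makes the linear terms in \<open>F\<close>
  cancel as well.\<close>

lemma F_relation:
  assumes x: "x \<in> annulus" and y: "y \<in> annulus" and xy: "x * y \<in> annulus"
  shows "(F x + F y - F (x * y) + 1 / 2)\<^sup>2 = D x + D y + D (x * y) + 1 / 4 - 6 * lambert1 Q"
proof -
  have "(F x + F y - F (x * y) + 1 / 2)\<^sup>2 = (F x)\<^sup>2 + (F y)\<^sup>2 + (F (x * y))\<^sup>2
      + 2 * (F x * F y - F (x * y) * (F x + F y)) + (F x + F y - F (x * y)) + 1 / 4"
    by (simp add: power2_eq_square algebra_simps)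
  then show ?thesis
    unfolding F_mult[OF assms] F_power2[OF x] F_power2[OF y] F_power2[OF xy]
    by (simp add: algebra_simps)
qed

end

subsection \<open>Autocorrelations\<close>

context odd_prime
begin

section \<open>Triple relations on residues\<close>

text \<open>Abstracts what the elliptic function and its degeneration at \<open>q = 0\<close> share,
  so that both obey the same linear relations between autocorrelations.\<close>

definition triple_relation :: "(int \<Rightarrow> complex) \<Rightarrow> (int \<Rightarrow> complex) \<Rightarrow> bool" where
  "triple_relation W P \<longleftrightarrow>
     (\<forall>a. W (a + int p) = W a) \<and> (\<forall>a. P (a + int p) = P a) \<and> (\<forall>a. W (- a) = - W a) \<and>
     (\<forall>a b. \<not> int p dvd a \<longrightarrow> \<not> int p dvd b \<longrightarrow> \<not> int p dvd a + b \<longrightarrow>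
        (W a + W b - W (a + b))\<^sup>2 = P a + P b + P (a + b))"

definition autocorrelation :: "(int \<Rightarrow> complex) \<Rightarrow> int \<Rightarrow> complex" where
  "autocorrelation W t = (\<Sum>a\<in>units. W a * W (t * a))"

text \<open>If the residues of \<open>a\<close> and \<open>b\<close> add without carry, the linear
  parts \<open>1 / 2 - a / p\<close> combine to \<open>1 / 2\<close> and the premise applies. With a
  carry, the residues of \<open>- a\<close> and \<open>- b\<close> add without one, and both sides
  are invariant under negation. A residue sum of exactly \<open>p\<close> is excluded.\<close>

lemma triple_relationI:
  fixes f d :: "int \<Rightarrow> complex" and k :: complex
  assumes f: "\<And>r. r \<in> units \<Longrightarrow> f (int p - r) = - f r"
    and d: "\<And>r. r \<in> units \<Longrightarrow> d (int p - r) = d r"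
    and rel: "\<And>r s. r \<in> units \<Longrightarrow> s \<in> units \<Longrightarrow> r + s \<in> units \<Longrightarrow>
      (f r + f s - f (r + s) + 1 / 2)\<^sup>2 = d r + d s + d (r + s) + 3 * k"
  shows "triple_relation
    (\<lambda>a. if int p dvd a then 0 else 1 / 2 - of_int (a mod int p) / of_nat p + f (a mod int p))
    (\<lambda>a. k + d (a mod int p))"
proof -
  let ?W = "\<lambda>a. if int p dvd a then 0 else 1 / 2 - of_int (a mod int p) / of_nat p + f (a mod int p)"
  let ?P = "\<lambda>a. k + d (a mod int p)"
  have neg: "(- a) mod int p = int p - a mod int p" if "\<not> int p dvd a" for a
    using that by (simp add: zmod_zminus1_eq_if dvd_eq_mod_eq_0)
  have W_neg: "?W (- a) = - ?W a" for a
    using f[OF mod_in_units, of a] neg[of a] p_gt_2 by (simp add: diff_divide_distrib)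
  have P_neg: "?P (- a) = ?P a" if "\<not> int p dvd a" for a
    using d[OF mod_in_units, of a] neg[of a] that by simp
  have small: "(?W a + ?W b - ?W (a + b))\<^sup>2 = ?P a + ?P b + ?P (a + b)"
    if ab: "\<not> int p dvd a" "\<not> int p dvd b" "\<not> int p dvd a + b" and lt: "a mod int p + b mod int p < int p" for a b
  proof -
    have m: "(a + b) mod int p = a mod int p + b mod int p"
    proof -
      have "(a + b) mod int p = (a mod int p + b mod int p) mod int p" by (simp only: mod_add_eq)
      also have "\<dots> = a mod int p + b mod int p"
        using lt p_gt_2 by (intro mod_pos_pos_trivial add_nonneg_nonneg pos_mod_sign) auto
      finally show ?thesis .
    qed
    note un = ab(1)[THEN mod_in_units] ab(2)[THEN mod_in_units] ab(3)[THEN mod_in_units, unfolded m]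
    have "?W a + ?W b - ?W (a + b) =
        f (a mod int p) + f (b mod int p) - f (a mod int p + b mod int p) + 1 / 2"
      using ab by (simp add: m add_divide_distrib)
    then have "(?W a + ?W b - ?W (a + b))\<^sup>2
        = d (a mod int p) + d (b mod int p) + d (a mod int p + b mod int p) + 3 * k"
      by (simp only: rel[OF un])
    then show ?thesis using m by simp
  qed
  have "(?W a + ?W b - ?W (a + b))\<^sup>2 = ?P a + ?P b + ?P (a + b)"
    if ab: "\<not> int p dvd a" "\<not> int p dvd b" "\<not> int p dvd a + b" for a b
  proof (cases "a mod int p + b mod int p < int p")
    case False
    have ab': "\<not> int p dvd - a" "\<not> int p dvd - b" "\<not> int p dvd - a + - b"
      unfolding minus_add_distrib[symmetric] dvd_minus_iff by (fact ab)+
    have "a mod int p + b mod int p \<noteq> int p"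
      using ab(3) by (metis dvd_refl mod_add_eq mod_0_imp_dvd mod_self)
    then have "(- a) mod int p + (- b) mod int p < int p" using False neg[OF ab(1)] neg[OF ab(2)] by simp
    from small[OF ab' this]
    have "(?W (- a) + ?W (- b) - ?W (- (a + b)))\<^sup>2 = ?P (- a) + ?P (- b) + ?P (- (a + b))"
      by (simp only: minus_add_distrib)
    then have "(- ?W a + - ?W b - - ?W (a + b))\<^sup>2 = ?P a + ?P b + ?P (a + b)"
      by (simp only: W_neg P_neg ab not_False_eq_True)
    moreover have "(- ?W a + - ?W b - - ?W (a + b))\<^sup>2 = (?W a + ?W b - ?W (a + b))\<^sup>2"
      by (simp add: power2_eq_square algebra_simps)
    ultimately show ?thesis by metis
  qed (use small ab in blast)
  then show ?thesis unfolding triple_relation_def using W_neg by auto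
qed

section \<open>Linear relations between autocorrelations\<close>

context
  fixes W P assumes rel: "triple_relation W P"
begin

abbreviation "R \<equiv> autocorrelation W"

lemma W_periodic: "W (a + int p) = W a"
  and P_periodic: "P (a + int p) = P a"
  and W_minus: "W (- a) = - W a"
  using rel by (auto simp: triple_relation_def)

lemma W_cong: "[a = b] (mod int p) \<Longrightarrow> W a = W b"
  using periodic_mod[of W a, OF W_periodic] periodic_mod[of W b, OF W_periodic] by (simp add: cong_def)

lemma autocorrelation_cong: "[s = t] (mod int p) \<Longrightarrow> R s = R t"
  unfolding autocorrelation_def by (intro sum.cong refl arg_cong2[where f = "(*)"] W_cong cong_mult) auto

lemma autocorrelation_minus: "R (- t) = - R t"
  unfolding autocorrelation_def by (simp add: W_minus sum_negf)

lemma sum_W_mult_W: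
  assumes "\<not> int p dvd t" "[u = s * t] (mod int p)"
  shows "(\<Sum>a\<in>units. W (t * a) * W (u * a)) = R s"
proof -
  have "(\<Sum>a\<in>units. W (t * a) * W (u * a)) = (\<Sum>a\<in>units. W (t * a) * W (s * (t * a)))"
    by (intro sum.cong refl arg_cong2[where f = "(*)"] W_cong)
      (metis assms(2) cong_mult cong_refl mult.assoc)
  also have "\<dots> = R s"
    unfolding autocorrelation_def using assms(1)
    by (intro sum_units_mult[of "\<lambda>b. W b * W (s * b)"])
      (auto simp: W_periodic distrib_left intro!: W_cong arg_cong2[where f = "(*)"] simp: cong_def)
  finally show ?thesis .
qed

text \<open>Reindexing by \<open>t\<close> exchanges the two factors of each product.\<close>

lemma autocorrelation_inverse:
  assumes "[s * t = 1] (mod int p)"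
  shows "R s = R t"
proof -
  have t: "\<not> int p dvd t"
  proof
    assume "int p dvd t"
    then have "[1 = 0] (mod int p)" using assms by (metis cong_0_iff cong_sym cong_trans dvd_mult)
    then show False using p_gt_2 by (simp add: cong_def)
  qed
  have "R s = (\<Sum>a\<in>units. W (t * a) * W (1 * a))"
    by (rule sum_W_mult_W[symmetric]) (use t cong_sym[OF assms] in auto)
  then show ?thesis by (simp add: autocorrelation_def mult.commute)
qed

text \<open>The triple relation at \<open>(a, t a)\<close> is summed over \<open>a\<close>. Each
  square gives \<open>R 1\<close>; the mixed products have index ratios \<open>t\<close>,
  \<open>t + 1\<close> and \<open>s\<close>, where \<open>s\<close> is \<open>(t + 1) / t\<close>
  modulo \<open>p\<close>.\<close>

lemma autocorrelation_relation:
  assumes t: "\<not> int p dvd t" "\<not> int p dvd t + 1" and s: "[t + 1 = s * t] (mod int p)"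
  shows "3 * R 1 + 2 * R t - 2 * R (t + 1) - 2 * R s = 3 * (\<Sum>a\<in>units. P a)"
proof -
  have "(\<Sum>a\<in>units. (W (1 * a) + W (t * a) - W ((t + 1) * a))\<^sup>2)
      = (\<Sum>a\<in>units. P a + P (t * a) + P ((t + 1) * a))"
  proof (rule sum.cong)
    fix a assume "a \<in> units"
    then have a: "\<not> int p dvd a" by (rule unitsD)
    have "\<not> int p dvd t * a" "\<not> int p dvd (t + 1) * a"
      unfolding dvd_mult_iff using t a by auto
    moreover have "a + t * a = (t + 1) * a" by (simp add: distrib_right)
    ultimately show "(W (1 * a) + W (t * a) - W ((t + 1) * a))\<^sup>2 = P a + P (t * a) + P ((t + 1) * a)"
      using rel a unfolding triple_relation_def by (metis mult_1)
  qed simp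
  also have "\<dots> = 3 * (\<Sum>a\<in>units. P a)"
    using t by (simp add: sum.distrib sum_units_mult P_periodic)
  finally have "3 * (\<Sum>a\<in>units. P a) =
      (\<Sum>a\<in>units. W (1 * a) * W (1 * a)) + (\<Sum>a\<in>units. W (t * a) * W (t * a))
      + (\<Sum>a\<in>units. W ((t + 1) * a) * W ((t + 1) * a)) + 2 * (\<Sum>a\<in>units. W (1 * a) * W (t * a))
      - 2 * (\<Sum>a\<in>units. W (1 * a) * W ((t + 1) * a)) - 2 * (\<Sum>a\<in>units. W (t * a) * W ((t + 1) * a))"
    by (simp only: sum.distrib[symmetric] sum_subtractf[symmetric] sum_distrib_left)
      (simp add: power2_eq_square algebra_simps)
  also have "\<dots> = R 1 + R 1 + R 1 + 2 * R t - 2 * R (t + 1) - 2 * R s"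
  proof -
    have "(\<Sum>a\<in>units. W (1 * a) * W (1 * a)) = R 1" "(\<Sum>a\<in>units. W (1 * a) * W (t * a)) = R t"
      "(\<Sum>a\<in>units. W (1 * a) * W ((t + 1) * a)) = R (t + 1)"
      using p_gt_2 by (intro sum_W_mult_W; simp)+
    moreover have "(\<Sum>a\<in>units. W (t * a) * W (t * a)) = R 1"
      "(\<Sum>a\<in>units. W ((t + 1) * a) * W ((t + 1) * a)) = R 1"
      using t by (intro sum_W_mult_W; simp)+
    moreover have "(\<Sum>a\<in>units. W (t * a) * W ((t + 1) * a)) = R s"
      by (rule sum_W_mult_W[OF t(1) s])
    ultimately show ?thesis by simp
  qed
  finally show ?thesis by simp
qed

text \<open>Substituting \<open>a = b * t\<close> in the first sum leaves \<open>\<psi> t\<close>,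
  because \<open>\<psi> b * cnj (\<psi> b) = 1\<close>.\<close>

lemma char_sum_mult_cnj:
  assumes \<psi>: "dirichlet_char p \<psi>"
  shows "(\<Sum>a\<in>units. \<psi> a * W a) * (\<Sum>b\<in>units. cnj (\<psi> b) * W b) = (\<Sum>t\<in>units. \<psi> t * R t)"
proof -
  have "(\<Sum>a\<in>units. \<psi> a * W a) * (\<Sum>b\<in>units. cnj (\<psi> b) * W b)
      = (\<Sum>b\<in>units. (\<Sum>a\<in>units. \<psi> a * W a) * (cnj (\<psi> b) * W b))"
    by (simp add: sum_distrib_left)
  also have "\<dots> = (\<Sum>b\<in>units. \<Sum>t\<in>units. \<psi> t * (W b * W (t * b)))"
  proof (rule sum.cong)
    fix b assume "b \<in> units"
    then have b: "\<not> int p dvd b" by (rule unitsD)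
    have "(\<Sum>a\<in>units. \<psi> a * W a) = (\<Sum>t\<in>units. \<psi> (b * t) * W (b * t))"
      using b by (intro sum_units_mult[symmetric]) (auto simp: W_periodic char_periodic[OF \<psi>])
    then have "(\<Sum>a\<in>units. \<psi> a * W a) * (cnj (\<psi> b) * W b)
       = (\<Sum>t\<in>units. \<psi> (b * t) * W (b * t) * (cnj (\<psi> b) * W b))"
      by (simp only: sum_distrib_right)
    also have "\<dots> = (\<Sum>t\<in>units. (\<psi> b * cnj (\<psi> b)) * (\<psi> t * (W b * W (t * b))))"
      by (simp add: char_mult[OF \<psi>] mult_ac)
    finally show "(\<Sum>a\<in>units. \<psi> a * W a) * (cnj (\<psi> b) * W b) = (\<Sum>t\<in>units. \<psi> t * (W b * W (t * b)))"
      by (simp only: char_mult_cnj[OF \<psi> b] mult_1)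
  qed simp
  also have "\<dots> = (\<Sum>t\<in>units. \<Sum>b\<in>units. \<psi> t * (W b * W (t * b)))" by (rule sum.swap)
  finally show ?thesis by (simp add: autocorrelation_def sum_distrib_left)
qed

end

section \<open>The degenerate solution at q = 0\<close>

text \<open>The negative of the Dedekind sawtooth \<open>((a / p))\<close>.\<close>

definition sawtooth :: "int \<Rightarrow> complex" where
  "sawtooth a = (if int p dvd a then 0 else 1 / 2 - of_int (a mod int p) / of_nat p)"

lemma triple_relation_sawtooth: "triple_relation sawtooth (\<lambda>_. 1 / 12)"
  \<comment> \<open>With \<open>f = d = 0\<close> the required relation is
    \<open>(1 / 2)^2 = 3 * (1 / 12)\<close>.\<close>
  using triple_relationI[of "\<lambda>_. 0" "\<lambda>_. 0" "1 / 12"]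
  by (simp add: power2_eq_square sawtooth_def[abs_def] cong: if_cong)

end

subsection \<open>Eisenstein series\<close>

context nome
begin

lemma u_minus_powi: "u (- int n) * x powi (- int n) = - ((Q / x) ^ n / (1 - Q ^ n))"
proof -
  have "u (- int n) = - (u (int n) * Q ^ n)" using u_mult_Q[of "int n"] by simp
  moreover have "u (int n) = 1 / (1 - Q ^ n)" by (simp add: u_def)
  ultimately show ?thesis
    unfolding power_int_minus power_int_of_nat power_divide by (simp add: divide_inverse)
qed

lemma F_sums:
  assumes x: "x \<in> annulus"
  shows "(\<lambda>n. (x ^ Suc n - (Q / x) ^ Suc n) / (1 - Q ^ Suc n)) sums F x"
proof -
  have "u (int n) * x powi int n + u (- int n) * x powi (- int n) = (x ^ n - (Q / x) ^ n) / (1 - Q ^ n)" for n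
    unfolding u_minus_powi by (simp add: u_def diff_divide_distrib)
  then show ?thesis
    using sums_infsum_int[OF abs_summable_summable[OF summable_F[OF x]]]
    by (simp only: F_def u_0 mult_zero_left simp_thms)
qed

lemma D_sums:
  assumes x: "x \<in> annulus"
  shows "(\<lambda>n. of_nat (Suc n) * ((x ^ Suc n + (Q / x) ^ Suc n) / (1 - Q ^ Suc n))) sums D x"
proof -
  have "of_int (int n) * u (int n) * x powi int n + of_int (- int n) * u (- int n) * x powi (- int n)
      = of_nat n * ((x ^ n + (Q / x) ^ n) / (1 - Q ^ n))" for n
    unfolding mult.assoc u_minus_powi by (simp add: u_def add_divide_distrib distrib_left)
  then show ?thesis
    using sums_infsum_int[OF abs_summable_summable[OF summable_D[OF x]]]
    by (simp only: D_def u_0 mult_zero_left mult_zero_right simp_thms)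
qed

end

context odd_prime
begin

section \<open>L-values and character-weighted power sums\<close>

lemma sum_units_nat: "(\<Sum>a\<in>units. f a) = (\<Sum>k=1..<p. f (int k))"
  by (rule sum.reindex_bij_witness[where i = int and j = nat]) auto

lemma sum_lessThan_p:
  fixes f :: "int \<Rightarrow> complex"
  shows "(\<Sum>k<p. f (int k)) = f 0 + (\<Sum>a\<in>units. f a)"
proof -
  have "{..<p} = insert 0 {1..<p}" using p_gt_2 by auto
  then show ?thesis unfolding sum_units_nat by simp
qed

lemma sum_units_reflect: "(\<Sum>a\<in>units. f (int p - a)) = (\<Sum>a\<in>units. f a)"
  by (rule sum.reindex_bij_witness[where i = "\<lambda>a. int p - a" and j = "\<lambda>a. int p - a"]) auto

text \<open>The constant \<open>1 / 2\<close> of the sawtooth costs nothing, since the character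
  sums to 0 over the units.\<close>

lemma dirichlet_L_odd:
  assumes \<psi>: "\<psi> \<in> odd_chars p"
  shows "dirichlet_L \<psi> 0 = (\<Sum>a\<in>units. \<psi> a * sawtooth a)"
proof -
  note char = odd_charsD(1)[OF \<psi>]
  have z: "\<psi> 0 = 0" using char_eq_0_iff[OF char] by simp
  have "dirichlet_L \<psi> 0 = - (\<Sum>k<p. of_nat k * \<psi> (int k)) / of_nat p"
    using p_gt_2 char_periodic[OF char] z sum_lessThan_p[of \<psi>] sum_char[OF \<psi>] by (intro dirichlet_L_0) auto
  also have "(\<Sum>k<p. of_nat k * \<psi> (int k)) = (\<Sum>a\<in>units. of_int a * \<psi> a)"
    using sum_lessThan_p[of "\<lambda>a. of_int a * \<psi> a"] by simp
  also have "- (\<Sum>a\<in>units. of_int a * \<psi> a) / of_nat p = (\<Sum>a\<in>units. \<psi> a) / 2 - (\<Sum>a\<in>units. of_int a * \<psi> a) / of_nat p"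
    using sum_char[OF \<psi>] by simp
  also have "\<dots> = (\<Sum>a\<in>units. \<psi> a / 2 - of_int a * \<psi> a / of_nat p)"
    by (simp only: sum_subtractf sum_divide_distrib)
  also have "\<dots> = (\<Sum>a\<in>units. \<psi> a * sawtooth a)"
    using unitsD by (intro sum.cong) (auto simp: sawtooth_def algebra_simps)
  finally show ?thesis .
qed

text \<open>Shifting the index by a period multiplies each term by \<open>w ^ p\<close>, so the
  series is its first block divided by \<open>1 - w ^ p\<close>.\<close>

lemma char_geometric_has_sum:
  assumes \<psi>: "dirichlet_char p \<psi>" and w: "norm w < 1"
  shows "((\<lambda>n. \<psi> (int (Suc n)) * w ^ Suc n) has_sum ((\<Sum>a\<in>units. \<psi> a * w ^ nat a) / (1 - w ^ p))) UNIV"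
proof -
  have bound: "norm (\<psi> a) \<le> 1" for a
    using norm_char[OF \<psi>, of a] char_eq_0_iff[OF \<psi>, of a] by (cases "int p dvd a") auto
  have z: "\<psi> 0 = 0" using char_eq_0_iff[OF \<psi>] by simp
  let ?g = "\<lambda>n. \<psi> (int n) * w ^ n"
  have "norm (norm (?g n)) \<le> norm w ^ n" for n
    using mult_right_mono[OF bound[of "int n"], of "norm w ^ n"] by (simp add: norm_mult norm_power)
  then have sum: "summable (\<lambda>n. norm (?g n))"
    using w by (intro summable_comparison_test'[OF summable_geometric[of "norm w"]]) auto
  have "w ^ p \<noteq> 1"
    using w p_gt_2 by (metis norm_one norm_power power_less_one_iff norm_ge_zero less_irrefl gr_implies_not0 not_gr_zero)
  have "suminf ?g = (\<Sum>n. ?g (n + p)) + sum ?g {..<p}"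
    by (rule suminf_split_initial_segment[OF summable_norm_cancel[OF sum]])
  also have "(\<Sum>n. ?g (n + p)) = w ^ p * suminf ?g"
    unfolding suminf_mult[OF summable_norm_cancel[OF sum], symmetric]
    by (simp add: char_periodic[OF \<psi>] power_add mult_ac)
  also have "sum ?g {..<p} = (\<Sum>a\<in>units. \<psi> a * w ^ nat a)"
    using sum_lessThan_p[of "\<lambda>a. \<psi> a * w ^ nat a"] z by simp
  finally have "suminf ?g = (\<Sum>a\<in>units. \<psi> a * w ^ nat a) / (1 - w ^ p)"
    using \<open>w ^ p \<noteq> 1\<close> by (simp add: field_simps)
  moreover have "?g sums suminf ?g" by (rule summable_sums[OF summable_norm_cancel[OF sum]])
  ultimately have "?g sums ((\<Sum>a\<in>units. \<psi> a * w ^ nat a) / (1 - w ^ p) + ?g 0)" using z by simp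
  then have "(\<lambda>n. ?g (Suc n)) sums ((\<Sum>a\<in>units. \<psi> a * w ^ nat a) / (1 - w ^ p))"
    by (rule sums_Suc_iff[of ?g, THEN iffD2])
  moreover have "summable (\<lambda>n. norm (?g (Suc n)))" using sum by (subst summable_Suc_iff)
  ultimately show ?thesis by (intro norm_summable_imp_has_sum)
qed

end

section \<open>Series at the points q^a\<close>

locale odd_prime_nome = odd_prime +
  fixes q :: complex
  assumes q_nonzero: "q \<noteq> 0" and norm_q: "norm q < 1"
begin

text \<open>With nome \<open>q ^ p\<close> the points \<open>q ^ r\<close> for
  \<open>0 < r < p\<close> lie in the annulus, and \<open>r \<mapsto> p - r\<close> becomes the
  reflection \<open>x \<mapsto> Q / x\<close>.\<close>

sublocale nome "q ^ p"
  using q_nonzero norm_q p_gt_2 by unfold_locales (auto simp: norm_power power_less_one_iff)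

lemma power_in_annulus: "r \<in> units \<Longrightarrow> q ^ nat r \<in> annulus"
  using q_nonzero norm_q by (auto simp: annulus_def norm_power power_less_one_iff intro!: power_strict_decreasing)

lemma power_reflect:
  assumes "r \<in> units"
  shows "q ^ nat (int p - r) = q ^ p / q ^ nat r"
proof -
  have "nat (int p - r) + nat r = nat (int p - r + r)"
    using assms by (intro nat_add_distrib[symmetric]) auto
  then have "p = nat (int p - r) + nat r" by simp
  then have "q ^ p = q ^ nat (int p - r) * q ^ nat r" by (metis power_add)
  then show ?thesis using q_nonzero by simp
qed

definition W :: "int \<Rightarrow> complex" where
  "W a = (if int p dvd a then 0 else 1 / 2 - of_int (a mod int p) / of_nat p + F (q ^ nat (a mod int p)))"

text \<open>The constant is one third of \<open>1 / 4 - 6 * lambert1 Q\<close> from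
  \<open>F_relation\<close>, distributed evenly over the three terms.\<close>

definition P :: "int \<Rightarrow> complex" where
  "P a = (1 / 12 - 2 * lambert1 (q ^ p)) + D (q ^ nat (a mod int p))"

lemma triple_relation_W: "triple_relation W P"
  unfolding W_def[abs_def] P_def[abs_def]
proof (rule triple_relationI)
  fix r s assume rs: "r \<in> units" "s \<in> units" "r + s \<in> units"
  then have "q ^ nat (r + s) = q ^ nat r * q ^ nat s" by (simp add: nat_add_distrib power_add)
  then show "(F (q ^ nat r) + F (q ^ nat s) - F (q ^ nat (r + s)) + 1 / 2)\<^sup>2
    = D (q ^ nat r) + D (q ^ nat s) + D (q ^ nat (r + s)) + 3 * (1 / 12 - 2 * lambert1 (q ^ p))"
    using F_relation[of "q ^ nat r" "q ^ nat s"] rs[THEN power_in_annulus] by simp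
qed (simp_all add: power_reflect F_reflect D_reflect power_in_annulus)

text \<open>For fixed \<open>k\<close> put \<open>z = q ^ k\<close>. By reflection both powers in
  the numerator have the same sum over the units, a finite geometric sum, and the resulting fraction
  splits as \<open>z / (1 - z) - z^p / (1 - z^p)\<close>.\<close>

lemma sum_D: "(\<Sum>a\<in>units. D (q ^ nat a)) = 2 * (lambert1 q - lambert1 (q ^ p))"
proof -
  have sums: "(\<lambda>n. \<Sum>a\<in>units. of_nat (Suc n) * (((q ^ nat a) ^ Suc n + (q ^ nat (int p - a)) ^ Suc n) / (1 - (q ^ p) ^ Suc n)))
      sums (\<Sum>a\<in>units. D (q ^ nat a))"
    using D_sums[OF power_in_annulus] by (intro sums_sum) (simp only: power_reflect)
  have eq: "(\<Sum>a\<in>units. of_nat k * (((q ^ nat a) ^ k + (q ^ nat (int p - a)) ^ k) / (1 - (q ^ p) ^ k)))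
      = 2 * (of_nat k * (q ^ k / (1 - q ^ k)) - of_nat k * ((q ^ p) ^ k / (1 - (q ^ p) ^ k)))"
    if "k > 0" for k :: nat
  proof -
    define z where "z = q ^ k"
    have z: "norm z < 1" using norm_q that by (simp add: z_def norm_power power_less_one_iff)
    then have z1: "z \<noteq> 1" by auto
    have "norm (z ^ p) < 1" using z p_gt_2 by (simp add: norm_power power_less_one_iff)
    then have zp: "z ^ p \<noteq> 1" by auto
    have pw: "(q ^ n) ^ k = z ^ n" for n by (simp add: z_def power_mult[symmetric] mult.commute)
    have "(\<Sum>a\<in>units. (q ^ nat a) ^ k + (q ^ nat (int p - a)) ^ k) = 2 * (\<Sum>a\<in>units. z ^ nat a)"
      using sum_units_reflect[of "\<lambda>a. z ^ nat a"] by (simp add: pw sum.distrib)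
    also have "(\<Sum>a\<in>units. z ^ nat a) = (z - z ^ p) / (1 - z)"
    proof -
      have "(\<Sum>a\<in>units. z ^ nat a) = (\<Sum>n=1..<p. z ^ n)" by (simp add: sum_units_nat)
      also have "(1 - z) * \<dots> = z - z ^ p"
        using sum_gp_multiplied[of 1 "p - 1" z] p_gt_2
        by (simp add: atLeastLessThanSuc_atLeastAtMost[symmetric])
      finally show ?thesis using z1 by (simp add: field_simps)
    qed
    finally have "(\<Sum>a\<in>units. of_nat k * (((q ^ nat a) ^ k + (q ^ nat (int p - a)) ^ k) / (1 - (q ^ p) ^ k)))
       = of_nat k * (2 * ((z - z ^ p) / (1 - z)) / (1 - z ^ p))"
      by (simp only: sum_distrib_left[symmetric] sum_divide_distrib[symmetric] pw)
    also have "2 * ((z - z ^ p) / (1 - z)) / (1 - z ^ p) = 2 * ((z - z ^ p) / (1 - z) / (1 - z ^ p))"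
      by (rule times_divide_eq_right[symmetric])
    also have "(z - z ^ p) / (1 - z) / (1 - z ^ p) = z / (1 - z) - z ^ p / (1 - z ^ p)"
      using z1 zp by (simp add: divide_simps) (simp add: algebra_simps)
    finally show ?thesis by (simp only: pw) (simp add: z_def algebra_simps)
  qed
  have "(\<lambda>n. 2 * (of_nat (Suc n) * (q ^ Suc n / (1 - q ^ Suc n))
        - of_nat (Suc n) * ((q ^ p) ^ Suc n / (1 - (q ^ p) ^ Suc n)))) sums (\<Sum>a\<in>units. D (q ^ nat a))"
    using sums by (simp only: eq[OF zero_less_Suc])
  moreover have "(\<lambda>n. 2 * (of_nat (Suc n) * (q ^ Suc n / (1 - q ^ Suc n))
        - of_nat (Suc n) * ((q ^ p) ^ Suc n / (1 - (q ^ p) ^ Suc n)))) sums (2 * (lambert1 q - lambert1 (q ^ p)))"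
    by (intro sums_mult sums_diff has_sum_imp_sums has_sum_lambert1 norm_q norm_Q)
  ultimately show ?thesis by (rule sums_unique2)
qed

lemma sum_P: "(\<Sum>a\<in>units. P a) = (of_nat p - 1) / 12 + 2 * (lambert1 q - of_nat p * lambert1 (q ^ p))"
proof -
  have "(\<Sum>a\<in>units. P a) = (\<Sum>a\<in>units. (1 / 12 - 2 * lambert1 (q ^ p)) + D (q ^ nat a))"
    by (intro sum.cong) (auto simp: P_def)
  also have "\<dots> = (of_nat p - 1) * (1 / 12 - 2 * lambert1 (q ^ p)) + 2 * (lambert1 q - lambert1 (q ^ p))"
    using p_gt_2 by (simp add: sum.distrib sum_D of_nat_diff del: sum_constant) (simp add: of_nat_diff)
  finally show ?thesis by (simp add: algebra_simps add_divide_distrib diff_divide_distrib)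
qed

lemma lambert1_coprime:
  "(\<Sum>n. principal_char p (int (Suc n)) * of_nat (Suc n) * q ^ Suc n / (1 - q ^ Suc n))
     = lambert1 q - of_nat p * lambert1 (q ^ p)"
proof -
  define f where "f n = of_nat n * (q ^ n / (1 - q ^ n))" for n
  have "((\<lambda>n. f (Suc n)) has_sum lambert1 q) UNIV"
    unfolding f_def by (rule has_sum_lambert1[OF norm_q])
  moreover have "((\<lambda>n. if p dvd Suc n then f (Suc n) else 0) has_sum of_nat p * lambert1 (q ^ p)) UNIV"
  \<comment> \<open>Index \<open>n\<close> stands for the summand \<open>Suc n\<close>, so the
    multiple \<open>p * Suc m\<close> sits at index \<open>p * Suc m - 1\<close>.\<close>
  proof (rule has_sum_supported_on_range[where h = "\<lambda>m. p * Suc m - 1"])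
    have p0: "Suc (p * Suc m - 1) = p * Suc m" for m using p_gt_2 by simp
    show "inj (\<lambda>m. p * Suc m - 1)"
      by (rule injI) (metis p0 mult_left_cancel nat.inject p_gt_2 less_nat_zero_code)
    have "f (p * Suc m) = of_nat p * (of_nat (Suc m) * ((q ^ p) ^ Suc m / (1 - (q ^ p) ^ Suc m)))" for m
      unfolding f_def by (simp only: power_mult of_nat_mult mult.assoc)
    then show "((\<lambda>m. if p dvd Suc (p * Suc m - 1) then f (Suc (p * Suc m - 1)) else 0)
        has_sum of_nat p * lambert1 (q ^ p)) UNIV"
      unfolding p0 using has_sum_cmult_right[OF has_sum_lambert1(1)[OF norm_Q], of "of_nat p"] by simp
    show "(if p dvd Suc n then f (Suc n) else 0) = 0" if "n \<notin> range (\<lambda>m. p * Suc m - 1)" for n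
    proof (cases "p dvd Suc n")
      case True
      then obtain k where k: "Suc n = p * k" by (auto elim: dvdE)
      then obtain m where "k = Suc m" by (cases k) auto
      then have "n = p * Suc m - 1" using k by simp
      then show ?thesis using that by blast
    qed simp
  qed
  ultimately have "((\<lambda>n. f (Suc n) - (if p dvd Suc n then f (Suc n) else 0)) has_sum
      (lambert1 q - of_nat p * lambert1 (q ^ p))) UNIV"
    by (rule has_sum_diff)
  moreover have "f (Suc n) - (if p dvd Suc n then f (Suc n) else 0)
      = principal_char p (int (Suc n)) * of_nat (Suc n) * q ^ Suc n / (1 - q ^ Suc n)" for n
    unfolding principal_char_def coprime_iff int_dvd_int_iff f_def by simp
  ultimately show ?thesis by (metis (no_types, lifting) ext has_sum_imp_sums sums_unique)
qed

text \<open>After the Lambert swap both sides are sums over \<open>k\<close> of finite character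
  sums in \<open>q^k\<close>. Oddness of \<open>\<psi>\<close> makes the terms with
  \<open>p - a\<close> repeat those with \<open>a\<close>, which accounts for the factor 2.\<close>

lemma char_lambert:
  assumes \<psi>: "\<psi> \<in> odd_chars p"
  shows "2 * (\<Sum>n. \<psi> (int (Suc n)) * (q ^ Suc n / (1 - q ^ Suc n))) = (\<Sum>a\<in>units. \<psi> a * F (q ^ nat a))"
proof -
  note char = odd_charsD(1)[OF \<psi>]
  have "norm (\<psi> (int (Suc n))) \<le> real (Suc n)" for n
    using norm_char[OF char, of "int (Suc n)"] char_eq_0_iff[OF char, of "int (Suc n)"]
    by (cases "int p dvd int (Suc n)") auto
  from has_sum_lambert_swap[OF norm_q this char_geometric_has_sum[OF char]]
  have lhs: "(\<lambda>n. 2 * ((\<Sum>a\<in>units. \<psi> a * (q ^ Suc n) ^ nat a) / (1 - (q ^ Suc n) ^ p)))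
      sums (2 * (\<Sum>n. \<psi> (int (Suc n)) * (q ^ Suc n / (1 - q ^ Suc n))))"
    by (intro sums_mult has_sum_imp_sums)
  have sums: "(\<lambda>n. \<Sum>a\<in>units. \<psi> a * (((q ^ nat a) ^ Suc n - (q ^ nat (int p - a)) ^ Suc n) / (1 - (q ^ p) ^ Suc n)))
      sums (\<Sum>a\<in>units. \<psi> a * F (q ^ nat a))"
    using F_sums[OF power_in_annulus] by (intro sums_sum sums_mult) (simp only: power_reflect)
  have eq: "(\<Sum>a\<in>units. \<psi> a * (((q ^ nat a) ^ k - (q ^ nat (int p - a)) ^ k) / (1 - (q ^ p) ^ k)))
      = 2 * ((\<Sum>a\<in>units. \<psi> a * (q ^ k) ^ nat a) / (1 - (q ^ k) ^ p))" for k
  proof -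
    define z where "z = q ^ k"
    have pw: "(q ^ n) ^ k = z ^ n" for n by (simp add: z_def power_mult[symmetric] mult.commute)
    have "\<psi> (int p - a) = - \<psi> a" for a
      using char_periodic[OF char, of "- a"] odd_charsD(2)[OF \<psi>, of a] by (simp add: add.commute)
    then have "(\<Sum>a\<in>units. \<psi> a * z ^ nat (int p - a)) = - (\<Sum>a\<in>units. \<psi> a * z ^ nat a)"
      using sum_units_reflect[of "\<lambda>a. \<psi> (int p - a) * z ^ nat a"] by (simp add: sum_negf)
    then have "(\<Sum>a\<in>units. \<psi> a * (z ^ nat a - z ^ nat (int p - a))) = 2 * (\<Sum>a\<in>units. \<psi> a * z ^ nat a)"
      by (simp add: right_diff_distrib sum_subtractf)
    then show ?thesis
      unfolding pw times_divide_eq_right sum_divide_distrib[symmetric] by (simp add: z_def)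
  qed
  from sums_unique2[OF lhs sums[unfolded eq]] show ?thesis .
qed

lemma sum_char_W:
  assumes \<psi>: "\<psi> \<in> odd_chars p"
  shows "(\<Sum>a\<in>units. \<psi> a * W a) = dirichlet_L \<psi> 0
     + 2 * (\<Sum>n. \<psi> (int (Suc n)) * (q ^ Suc n / (1 - q ^ Suc n)))"
proof -
  have "(\<Sum>a\<in>units. \<psi> a * W a) = (\<Sum>a\<in>units. \<psi> a * sawtooth a + \<psi> a * F (q ^ nat a))"
    using unitsD by (intro sum.cong) (auto simp: W_def sawtooth_def algebra_simps)
  then show ?thesis by (simp only: sum.distrib dirichlet_L_odd[OF \<psi>] char_lambert[OF \<psi>])
qed

end

section \<open>The mean square of the Eisenstein series\<close>

context odd_prime
begin

lemma sum_units_even: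
  fixes h :: "int \<Rightarrow> complex"
  assumes per: "\<And>a. h (a + int p) = h a" and even: "\<And>a. h (- a) = h a" and m: "int p = 2 * m + 1"
  shows "(\<Sum>a\<in>units. h a) = 2 * (\<Sum>a=1..m. h a)"
proof -
  have "units = {1..m} \<union> {m<..<int p}" using m by auto
  then have "(\<Sum>a\<in>units. h a) = (\<Sum>a=1..m. h a) + (\<Sum>a\<in>{m<..<int p}. h a)"
    by (simp only:) (subst sum.union_disjoint; auto)
  also have "(\<Sum>a\<in>{m<..<int p}. h a) = (\<Sum>a=1..m. h a)"
  proof (rule sum.reindex_bij_witness[where i = "\<lambda>a. int p - a" and j = "\<lambda>a. int p - a"])
    show "h (int p - a) = h a" for a using per[of "- a"] even[of a] by (simp add: add.commute)
  qed (use m in auto)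
  finally show ?thesis by simp
qed

lemma eis_periodic: "eis (a + int p) p \<tau> = eis a p \<tau>"
  unfolding eis_def using odd_charsD(1) char_periodic by (auto intro!: sum.cong arg_cong2[where f = "(*)"])

lemma eis_minus: "eis (- a) p \<tau> = - eis a p \<tau>"
proof -
  have "(\<Sum>\<psi>\<in>odd_chars p. \<psi> (- a) * eis_char \<psi> \<tau>) = (\<Sum>\<psi>\<in>odd_chars p. - (\<psi> a * eis_char \<psi> \<tau>))"
  proof (rule sum.cong)
    fix \<psi> assume "\<psi> \<in> odd_chars p"
    from odd_charsD(2)[OF this, of a] show "\<psi> (- a) * eis_char \<psi> \<tau> = - (\<psi> a * eis_char \<psi> \<tau>)" by simp
  qed simp
  then show ?thesis by (simp add: eis_def sum_negf)
qed

text \<open>The factor \<open>k \<psi>\<close> is the same for every solution \<open>(W, P)\<close>.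
  Used for the sawtooth it evaluates a product of two L-values, used for the elliptic solution the
  corresponding numerators; in the quotient it cancels.\<close>

lemma sum_eis_power2:
  assumes k_nz: "\<And>\<psi>. \<psi> \<in> odd_chars p \<Longrightarrow> k \<psi> \<noteq> 0"
    and k: "\<And>\<psi> W P. \<psi> \<in> odd_chars p \<Longrightarrow> triple_relation W P \<Longrightarrow>
      (\<Sum>t\<in>units. \<psi> t * autocorrelation W t) = k \<psi> * (\<Sum>a\<in>units. P a)"
    and \<tau>: "Im \<tau> > 0"
  shows "(\<Sum>a\<in>units. (eis a p \<tau>)\<^sup>2) = 2 * (1 + 24 / (of_nat p - 1) * lambert2 p \<tau>)"
proof -
  interpret odd_prime_nome p "qpar \<tau>"
    using \<tau> by unfold_locales (auto simp: qpar_def)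
  let ?c = "\<lambda>\<psi> a. cnj (\<psi> a)"
  define E where "E \<psi> = eis_char \<psi> \<tau>" for \<psi>
  define V where "V = 1 + 24 / (of_nat p - 1) * lambert2 p \<tau>"
  have p1: "of_nat p - 1 \<noteq> (0 :: complex)"
    using p_gt_2 by (metis of_nat_1 of_nat_eq_iff eq_iff_diff_eq_0 less_numeral_extra(4) one_less_numeral_iff order.strict_trans semiring_norm(76))
  have V: "(\<Sum>a\<in>units. P a) = (of_nat p - 1) / 12 * V"
  proof -
    have "lambert2 p \<tau> = lambert1 (qpar \<tau>) - of_nat p * lambert1 (qpar \<tau> ^ p)"
      by (simp only: lambert2_def lambert1_coprime)
    then have sum_P': "(\<Sum>a\<in>units. P a) = (of_nat p - 1) / 12 + 2 * lambert2 p \<tau>" by (simp only: sum_P)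
    show ?thesis unfolding sum_P' V_def using p1 by (simp add: field_simps)
  qed
  have E_mult: "E \<psi> * E (?c \<psi>) = V" if \<psi>: "\<psi> \<in> odd_chars p" for \<psi>
  proof -
    note c\<psi> = cnj_odd_char[OF \<psi>]
    have L: "dirichlet_L \<psi> 0 * dirichlet_L (?c \<psi>) 0 = k \<psi> * ((of_nat p - 1) / 12)"
      using char_sum_mult_cnj[OF triple_relation_sawtooth odd_charsD(1)[OF \<psi>]] k[OF \<psi> triple_relation_sawtooth]
        p_gt_2 by (simp add: dirichlet_L_odd[OF \<psi>] dirichlet_L_odd[OF c\<psi>] of_nat_diff)
    \<comment> \<open>Nonvanishing of the L-values follows from \<open>k \<psi> \<noteq> 0\<close>,
      through their product.\<close>
    then have nz: "dirichlet_L \<psi> 0 \<noteq> 0" "dirichlet_L (?c \<psi>) 0 \<noteq> 0"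
      using k_nz[OF \<psi>] p1 by auto
    have E: "E \<phi> = (\<Sum>a\<in>units. \<phi> a * W a) / dirichlet_L \<phi> 0"
      if "\<phi> \<in> odd_chars p" "dirichlet_L \<phi> 0 \<noteq> 0" for \<phi>
      using that(2) unfolding sum_char_W[OF that(1)] E_def eis_char_def by (simp add: add_divide_distrib)
    have "E \<psi> * E (?c \<psi>) = k \<psi> * ((of_nat p - 1) / 12 * V) / (k \<psi> * ((of_nat p - 1) / 12))"
      unfolding E[OF \<psi> nz(1)] E[OF c\<psi> nz(2)] times_divide_times_eq L
      by (simp only: char_sum_mult_cnj[OF triple_relation_W odd_charsD(1)[OF \<psi>]] k[OF \<psi> triple_relation_W] V)
    then show ?thesis using k_nz[OF \<psi>] p1 by simp
  qed
  \<comment> \<open>Expand the square and sum over \<open>a\<close> first: orthogonality keeps only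
    the pairs of a character with its conjugate, each contributing \<open>V * (p - 1)\<close>. There
    are \<open>(p - 1) / 2\<close> of them.\<close>
  have "(\<Sum>a\<in>units. (\<Sum>\<psi>\<in>odd_chars p. \<psi> a * E \<psi>)\<^sup>2)
      = (\<Sum>a\<in>units. \<Sum>\<psi>\<in>odd_chars p. \<Sum>\<phi>\<in>odd_chars p. E \<psi> * E \<phi> * (\<psi> a * \<phi> a))"
    by (simp add: power2_eq_square sum_product mult_ac)
  also have "\<dots> = (\<Sum>\<psi>\<in>odd_chars p. \<Sum>\<phi>\<in>odd_chars p. E \<psi> * E \<phi> * (\<Sum>a\<in>units. \<psi> a * \<phi> a))"
    by (subst sum.swap) (simp add: sum.swap[of _ _ units] sum_distrib_left)
  also have "\<dots> = (\<Sum>\<psi>\<in>odd_chars p. V * (of_nat p - 1))"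
  proof (rule sum.cong)
    fix \<psi> assume \<psi>: "\<psi> \<in> odd_chars p"
    have "(\<Sum>\<phi>\<in>odd_chars p. E \<psi> * E \<phi> * (\<Sum>a\<in>units. \<psi> a * \<phi> a))
        = (\<Sum>\<phi>\<in>odd_chars p. if \<phi> = ?c \<psi> then E \<psi> * E (?c \<psi>) * (of_nat p - 1) else 0)"
      using odd_charsD(1) \<psi> by (intro sum.cong) (auto simp: sum_char_mult_char)
    also have "\<dots> = E \<psi> * E (?c \<psi>) * (of_nat p - 1)"
      using cnj_odd_char[OF \<psi>] finite_odd_chars by simp
    finally show "(\<Sum>\<phi>\<in>odd_chars p. E \<psi> * E \<phi> * (\<Sum>a\<in>units. \<psi> a * \<phi> a)) = V * (of_nat p - 1)"
      by (simp only: E_mult[OF \<psi>])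
  qed simp
  also have "\<dots> = of_nat ((p - 1) div 2) * (V * (of_nat p - 1))" by (simp add: card_odd_chars)
  also have "of_nat ((p - 1) div 2) = (of_nat p - 1) / (2 :: complex)"
    using odd_p by (auto elim!: oddE)
  finally have "(\<Sum>a\<in>units. (\<Sum>\<psi>\<in>odd_chars p. \<psi> a * E \<psi>)\<^sup>2) = (of_nat p - 1)\<^sup>2 / 2 * V"
    by (simp add: power2_eq_square)
  then have "(\<Sum>a\<in>units. (eis a p \<tau>)\<^sup>2) = (2 / (of_nat p - 1))\<^sup>2 * ((of_nat p - 1)\<^sup>2 / 2 * V)"
    unfolding eis_def power_mult_distrib sum_distrib_left[symmetric] E_def by simp
  also have "\<dots> = 2 * V" using p1 by (simp add: power_divide)
  finally show ?thesis by (simp only: V_def)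
qed

lemma sum_char_autocorrelation:
  assumes \<psi>: "\<psi> \<in> odd_chars p" and rel: "triple_relation W P" and m: "int p = 2 * m + 1"
  shows "(\<Sum>t\<in>units. \<psi> t * autocorrelation W t) = 2 * (\<Sum>t=1..m. \<psi> t * autocorrelation W t)"
proof (rule sum_units_even[OF _ _ m])
  show "\<psi> (t + int p) * autocorrelation W (t + int p) = \<psi> t * autocorrelation W t" for t
    using autocorrelation_cong[OF rel, of "t + int p" t] char_periodic[OF odd_charsD(1)[OF \<psi>]]
    by (simp add: cong_def)
  show "\<psi> (- t) * autocorrelation W (- t) = \<psi> t * autocorrelation W t" for t
    using odd_charsD(2)[OF \<psi>] autocorrelation_minus[OF rel] by simp
qed

lemma sum_eis_power2_half:
  assumes m: "int p = 2 * m + 1"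
    and k_nz: "\<And>\<psi>. \<psi> \<in> odd_chars p \<Longrightarrow> k \<psi> \<noteq> 0"
    and k: "\<And>\<psi> W P. \<psi> \<in> odd_chars p \<Longrightarrow> triple_relation W P \<Longrightarrow>
      (\<Sum>t\<in>units. \<psi> t * autocorrelation W t) = k \<psi> * (\<Sum>a\<in>units. P a)"
    and \<tau>: "Im \<tau> > 0"
  shows "1 + 24 / (of_nat p - 1) * lambert2 p \<tau> = (\<Sum>a=1..m. (eis a p \<tau>)\<^sup>2)"
proof -
  have "(\<Sum>a\<in>units. (eis a p \<tau>)\<^sup>2) = 2 * (\<Sum>a=1..m. (eis a p \<tau>)\<^sup>2)"
    by (intro sum_units_even m) (simp_all only: eis_periodic eis_minus power2_minus)
  with sum_eis_power2[OF k_nz k \<tau>]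
  have "2 * (1 + 24 / (of_nat p - 1) * lambert2 p \<tau>) = 2 * (\<Sum>a=1..m. (eis a p \<tau>)\<^sup>2)"
    by (rule trans[OF sym])
  then show ?thesis by (subst (asm) mult_cancel_left) simp
qed

end

section \<open>The levels 5, 7 and 13\<close>

lemma eis_identity_5:
  assumes "Im \<tau> > 0"
  shows "1 + 6 * lambert2 5 \<tau> = (eis 1 5 \<tau>)\<^sup>2 + (eis 2 5 \<tau>)\<^sup>2"
proof -
  interpret odd_prime 5 by unfold_locales auto
  have half: "{1..2} = {1, 2 :: int}" by auto
  have "(\<Sum>t\<in>units. \<psi> t * autocorrelation W t) = 6 / 5 * (\<Sum>a\<in>units. P a)"
    if \<psi>: "\<psi> \<in> odd_chars 5" and rel: "triple_relation W P" for \<psi> W P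
  proof -
    let ?R = "autocorrelation W"
    \<comment> \<open>Modulo 5 the inverse of 2 is 3, which is also -2, so \<open>?R 2\<close>
      equals its own negative.\<close>
    have "?R 2 = ?R 3" by (rule autocorrelation_inverse[OF rel]) (simp add: cong_def)
    also have "\<dots> = ?R (- 2)" by (rule autocorrelation_cong[OF rel]) (simp add: cong_def)
    finally have R2: "?R 2 = 0" by (simp add: autocorrelation_minus[OF rel])
    \<comment> \<open>The relation for \<open>t = 1\<close>, where
      \<open>(t + 1) / t = 2\<close>.\<close>
    have "3 * ?R 1 + 2 * ?R 1 - 2 * ?R (1 + 1) - 2 * ?R 2 = 3 * (\<Sum>a\<in>units. P a)"
      by (rule autocorrelation_relation[OF rel]) (simp_all add: cong_def)
    then have "?R 1 = 3 / 5 * (\<Sum>a\<in>units. P a)" by (simp add: R2 field_simps)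
    then show ?thesis
      using sum_char_autocorrelation[OF \<psi> rel, of 2] R2 char_1[OF odd_charsD(1)[OF \<psi>]]
      by (simp add: half field_simps)
  qed
  from sum_eis_power2_half[of 2 "\<lambda>_. 6 / 5", OF _ _ this assms]
  show ?thesis by (simp add: half)
qed

lemma eis_identity_7:
  assumes "Im \<tau> > 0"
  shows "1 + 4 * lambert2 7 \<tau> = (eis 1 7 \<tau>)\<^sup>2 + (eis 2 7 \<tau>)\<^sup>2 + (eis 3 7 \<tau>)\<^sup>2"
proof -
  interpret odd_prime 7 by unfold_locales auto
  have half: "{1..3} = {1, 2, 3 :: int}" by auto
  \<comment> \<open>Twice the sum of \<open>\<psi> t * R t\<close> over \<open>t = 1, 2, 3\<close>,
    with \<open>R\<close> in units of the sum of \<open>P\<close>: the values are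
    \<open>5/7\<close>, \<open>1/7\<close> and \<open>-1/7\<close>. It is nonzero because
    \<open>5\<close> exceeds the norm of a difference of two unit numbers.\<close>
  define k where "k \<psi> = 2 * (5 / 7 + 1 / 7 * (\<psi> 2 - \<psi> 3))" for \<psi> :: "int \<Rightarrow> complex"
  have "k \<psi> \<noteq> 0" if \<psi>: "\<psi> \<in> odd_chars 7" for \<psi>
  proof
    assume "k \<psi> = 0"
    moreover have "7 / 2 * k \<psi> = 5 + (\<psi> 2 - \<psi> 3)" by (simp add: k_def algebra_simps)
    ultimately have "5 + (\<psi> 2 - \<psi> 3) = 0" by simp
    then have "5 = - (\<psi> 2 - \<psi> 3)" by (simp only: eq_neg_iff_add_eq_0)
    then have "5 = \<psi> 3 - \<psi> 2" by (simp only: minus_diff_eq)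
    then have "norm (\<psi> 3 - \<psi> 2) = 5" by (metis norm_numeral)
    then show False
      using norm_triangle_ineq4[of "\<psi> 3" "\<psi> 2"] norm_char[OF odd_charsD(1)[OF \<psi>]] by simp
  qed
  moreover have "(\<Sum>t\<in>units. \<psi> t * autocorrelation W t) = k \<psi> * (\<Sum>a\<in>units. P a)"
    if \<psi>: "\<psi> \<in> odd_chars 7" and rel: "triple_relation W P" for \<psi> W P
  proof -
    let ?R = "autocorrelation W" and ?P = "\<Sum>a\<in>units. P a"
    have "?R 2 = ?R 4" by (rule autocorrelation_inverse[OF rel]) (simp add: cong_def)
    also have "\<dots> = ?R (- 3)" by (rule autocorrelation_cong[OF rel]) (simp add: cong_def)
    finally have R3: "?R 3 = - ?R 2" by (simp add: autocorrelation_minus[OF rel])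
    have "?R 5 = ?R (- 2)" by (rule autocorrelation_cong[OF rel]) (simp add: cong_def)
    then have R5: "?R 5 = - ?R 2" by (simp add: autocorrelation_minus[OF rel])
    \<comment> \<open>The cases \<open>t = 1\<close> and \<open>t = 2\<close>; modulo 7 the quotient
      \<open>3 / 2\<close> is 5. The reduced system has determinant 42, and the combinations below
      are Cramer's rule.\<close>
    have "3 * ?R 1 + 2 * ?R 1 - 2 * ?R (1 + 1) - 2 * ?R 2 = 3 * ?P"
      "3 * ?R 1 + 2 * ?R 2 - 2 * ?R (2 + 1) - 2 * ?R 5 = 3 * ?P"
      by (rule autocorrelation_relation[OF rel]; simp add: cong_def)+
    then have e: "5 * ?R 1 - 4 * ?R 2 = 3 * ?P" "3 * ?R 1 + 6 * ?R 2 = 3 * ?P" by (simp_all add: R3 R5 algebra_simps)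
    have "?R 1 = (6 * (5 * ?R 1 - 4 * ?R 2) + 4 * (3 * ?R 1 + 6 * ?R 2)) / 42" by (simp add: algebra_simps)
    also have "\<dots> = 5 / 7 * ?P" unfolding e by simp
    finally have R1: "?R 1 = 5 / 7 * ?P" .
    have "?R 2 = (5 * (3 * ?R 1 + 6 * ?R 2) - 3 * (5 * ?R 1 - 4 * ?R 2)) / 42" by (simp add: algebra_simps)
    also have "\<dots> = 1 / 7 * ?P" unfolding e by simp
    finally have R2: "?R 2 = 1 / 7 * ?P" .
    have "(\<Sum>t\<in>units. \<psi> t * ?R t) = 2 * (\<Sum>t=1..3. \<psi> t * ?R t)"
      by (rule sum_char_autocorrelation[OF \<psi> rel]) simp
    also have "(\<Sum>t=1..3. \<psi> t * ?R t) = \<psi> 1 * ?R 1 + \<psi> 2 * ?R 2 + \<psi> 3 * ?R 3"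
      by (simp add: half)
    finally show ?thesis
      unfolding R1 R2 R3 char_1[OF odd_charsD(1)[OF \<psi>]] k_def by (simp add: algebra_simps)
  qed
  ultimately show ?thesis
    using sum_eis_power2_half[of 3 k, OF _ _ _ assms] by (simp add: half)
qed

lemma eis_identity_13:
  assumes "Im \<tau> > 0"
  shows "1 + 2 * lambert2 13 \<tau> =
    (eis 1 13 \<tau>)\<^sup>2 + (eis 2 13 \<tau>)\<^sup>2 + (eis 3 13 \<tau>)\<^sup>2
    + (eis 4 13 \<tau>)\<^sup>2 + (eis 5 13 \<tau>)\<^sup>2 + (eis 7 13 \<tau>)\<^sup>2"
proof -
  interpret odd_prime 13 by unfold_locales auto
  have half: "{1..6} = {1, 2, 3, 4, 5, 6 :: int}" by auto
  \<comment> \<open>The relative values of \<open>R t\<close> for \<open>t = 1, ..., 6\<close> are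
    \<open>11/13\<close>, \<open>4/13\<close>, \<open>1/13\<close>, \<open>-1/13\<close>,
    \<open>0\<close> and \<open>-4/13\<close>. Nonvanishing is a close call: 11 against at most
    \<open>4 * 2 + 2 = 10\<close>.\<close>
  define k where "k \<psi> = 2 * (11 / 13 + 4 / 13 * (\<psi> 2 - \<psi> 6) + 1 / 13 * (\<psi> 3 - \<psi> 4))" for \<psi> :: "int \<Rightarrow> complex"
  have "k \<psi> \<noteq> 0" if \<psi>: "\<psi> \<in> odd_chars 13" for \<psi>
  proof
    assume "k \<psi> = 0"
    moreover have "13 / 2 * k \<psi> = 11 + (4 * (\<psi> 2 - \<psi> 6) + (\<psi> 3 - \<psi> 4))"
      by (simp add: k_def field_simps)
    ultimately have "11 + (4 * (\<psi> 2 - \<psi> 6) + (\<psi> 3 - \<psi> 4)) = 0" by simp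
    then have "11 = - (4 * (\<psi> 2 - \<psi> 6) + (\<psi> 3 - \<psi> 4))" by (simp only: eq_neg_iff_add_eq_0)
    then have "11 = 4 * (\<psi> 6 - \<psi> 2) + (\<psi> 4 - \<psi> 3)" by simp
    then have "11 = norm (4 * (\<psi> 6 - \<psi> 2) + (\<psi> 4 - \<psi> 3))" by (metis norm_numeral)
    also have "\<dots> \<le> norm (4 * (\<psi> 6 - \<psi> 2)) + norm (\<psi> 4 - \<psi> 3)"
      by (rule norm_triangle_ineq)
    also have "norm (4 * (\<psi> 6 - \<psi> 2)) = 4 * norm (\<psi> 6 - \<psi> 2)"
      by (simp only: norm_mult norm_numeral)
    also have "4 * norm (\<psi> 6 - \<psi> 2) + norm (\<psi> 4 - \<psi> 3) \<le> 4 * (norm (\<psi> 6) + norm (\<psi> 2)) + (norm (\<psi> 4) + norm (\<psi> 3))"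
      by (intro add_mono mult_left_mono norm_triangle_ineq4) auto
    finally show False using norm_char[OF odd_charsD(1)[OF \<psi>]] by simp
  qed
  moreover have "(\<Sum>t\<in>units. \<psi> t * autocorrelation W t) = k \<psi> * (\<Sum>a\<in>units. P a)"
    if \<psi>: "\<psi> \<in> odd_chars 13" and rel: "triple_relation W P" for \<psi> W P
  proof -
    let ?R = "autocorrelation W" and ?P = "\<Sum>a\<in>units. P a"
    have minus: "?R s = - ?R t" if "[s = - t] (mod int 13)" for s t
      using autocorrelation_cong[OF rel that] by (simp add: autocorrelation_minus[OF rel])
    \<comment> \<open>Inversion and negation modulo 13 leave three unknowns \<open>?R 1\<close>,
      \<open>?R 2\<close> and \<open>?R 3\<close>. Since 8 is both the inverse and the negative of
      5, \<open>?R 5\<close> vanishes.\<close>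
    have "?R 5 = ?R 8" "?R 2 = ?R 7" "?R 3 = ?R 9" "?R 10 = ?R 4"
      by (rule autocorrelation_inverse[OF rel]; simp add: cong_def)+
    moreover have "?R 8 = - ?R 5" "?R 7 = - ?R 6" "?R 9 = - ?R 4"
      by (rule minus; simp add: cong_def)+
    ultimately have R: "?R 5 = 0" "?R 8 = 0" "?R 6 = - ?R 2" "?R 4 = - ?R 3" "?R 10 = - ?R 3"
      by auto
    \<comment> \<open>The cases \<open>t = 1, 2, 3\<close>, with quotients \<open>3 / 2 = 8\<close>
      and \<open>4 / 3 = 10\<close> modulo 13. The reduced system has determinant 156; the weights
      below invert it, with common factors removed.\<close>
    have "3 * ?R 1 + 2 * ?R 1 - 2 * ?R (1 + 1) - 2 * ?R 2 = 3 * ?P"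
      "3 * ?R 1 + 2 * ?R 2 - 2 * ?R (2 + 1) - 2 * ?R 8 = 3 * ?P"
      "3 * ?R 1 + 2 * ?R 3 - 2 * ?R (3 + 1) - 2 * ?R 10 = 3 * ?P"
      by (rule autocorrelation_relation[OF rel]; simp add: cong_def)+
    then have e: "5 * ?R 1 - 4 * ?R 2 = 3 * ?P" "3 * ?R 1 + 2 * ?R 2 - 2 * ?R 3 = 3 * ?P"
      "3 * ?R 1 + 6 * ?R 3 = 3 * ?P" by (simp_all add: R algebra_simps)
    have "?R 1 = (3 * (5 * ?R 1 - 4 * ?R 2) + 6 * (3 * ?R 1 + 2 * ?R 2 - 2 * ?R 3) + 2 * (3 * ?R 1 + 6 * ?R 3)) / 39" by (simp add: algebra_simps)
    also have "\<dots> = 11 / 13 * ?P" unfolding e by simp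
    finally have R1: "?R 1 = 11 / 13 * ?P" .
    have "?R 2 = (30 * (3 * ?R 1 + 2 * ?R 2 - 2 * ?R 3) + 10 * (3 * ?R 1 + 6 * ?R 3) - 24 * (5 * ?R 1 - 4 * ?R 2)) / 156" by (simp add: algebra_simps)
    also have "\<dots> = 4 / 13 * ?P" unfolding e by simp
    finally have R2: "?R 2 = 4 / 13 * ?P" .
    have "?R 3 = (11 * (3 * ?R 1 + 6 * ?R 3) - 3 * (5 * ?R 1 - 4 * ?R 2) - 6 * (3 * ?R 1 + 2 * ?R 2 - 2 * ?R 3)) / 78" by (simp add: algebra_simps)
    also have "\<dots> = 1 / 13 * ?P" unfolding e by simp
    finally have R3: "?R 3 = 1 / 13 * ?P" .
    have "(\<Sum>t\<in>units. \<psi> t * ?R t) = 2 * (\<Sum>t=1..6. \<psi> t * ?R t)"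
      by (rule sum_char_autocorrelation[OF \<psi> rel]) simp
    also have "(\<Sum>t=1..6. \<psi> t * ?R t) = \<psi> 1 * ?R 1 + \<psi> 2 * ?R 2 + \<psi> 3 * ?R 3 + \<psi> 4 * ?R 4 + \<psi> 5 * ?R 5 + \<psi> 6 * ?R 6"
      by (simp add: half)
    finally show ?thesis
      unfolding R R1 R2 R3 char_1[OF odd_charsD(1)[OF \<psi>]] k_def by (simp add: algebra_simps diff_divide_distrib)
  qed
  \<comment> \<open>The half system \<open>1, ..., 6\<close> is matched with the indices of the
    theorem by \<open>7 = -6\<close> modulo 13; the sign disappears in the square.\<close>
  moreover have "(eis 7 13 \<tau>)\<^sup>2 = (eis 6 13 \<tau>)\<^sup>2"
    using eis_periodic[of "- 6" \<tau>] eis_minus[of 6 \<tau>] by simp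
  ultimately show ?thesis
    using sum_eis_power2_half[of 6 k, OF _ _ _ assms] by (simp add: half)
qed

theorem theorem4p3:
  fixes \<tau> :: complex
  assumes "Im \<tau> > 0"
  shows "1 + 6 * lambert2 5 \<tau> = (eis 1 5 \<tau>)\<^sup>2 + (eis 2 5 \<tau>)\<^sup>2 \<and>
         1 + 4 * lambert2 7 \<tau> = (eis 1 7 \<tau>)\<^sup>2 + (eis 2 7 \<tau>)\<^sup>2 + (eis 3 7 \<tau>)\<^sup>2 \<and>
         1 + 2 * lambert2 13 \<tau> =
           (eis 1 13 \<tau>)\<^sup>2 + (eis 2 13 \<tau>)\<^sup>2 + (eis 3 13 \<tau>)\<^sup>2
           + (eis 4 13 \<tau>)\<^sup>2 + (eis 5 13 \<tau>)\<^sup>2 + (eis 7 13 \<tau>)\<^sup>2"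
  using eis_identity_5[OF assms] eis_identity_7[OF assms] eis_identity_13[OF assms] by simp

end
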